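(* Let $\mathbb{F}$ be a field, let $V$ be an $\mathbb{F}$-vector space, and let $\mathcal{A}$ be an algebra of linear operators on $V$, i.e. a subalgebra of $\operatorname{End}_{\mathbb{F}}(V)$. Let $m,n\ge 1$. If $f_1,\ldots,f_m\in\mathbb{F}\langle X_1,\ldots,X_n\rangle$ are $\mathcal{A}$-locally directionally linearly dependent and $\mathcal{A}$ does not satisfy a polynomial identity of degree $$\gamma:=\frac{(d+1)(d+2)}{2}\Big(m-1+\sum_{j=1}^m\deg(f_j)\Big)+d,\qquad\text{where } d=(m-1)\,m!,$$ then $f_1,\ldots,f_m$ are linearly dependent in $\mathbb{F}\langle X_1,\ldots,X_n\rangle$ over $\mathbb{F}$.
   Context: Algebras are associative and unital, and a subalgebra of $\operatorname{End}_{\mathbb{F}}(V)$ (the algebra of all $\mathbb{F}$-linear maps $V\to V$) contains the identity operator; $\mathbb{F}$ is an arbitrary field and $V$ may be infinite dimensional. $\mathbb{F}\langle X_1,\ldots,X_n\rangle$ is the free associative unital $\mathbb{F}$-algebra (polynomials in noncommuting variables), and $\deg$ is the total degree, i.e. the maximal length of a word occurring with nonzero coefficient. For $p\in\mathbb{F}\langle X_1,\ldots,X_n\rangle$ and $a\in\mathcal{A}^n$, $p(a)\in\mathcal{A}$ is the evaluation of $p$ at $X_i=a_i$ (the empty word evaluates to the identity). Polynomials $f_1,\ldots,f_m$ are $\mathcal{A}$-locally directionally linearly dependent if for every $a\in\mathcal{A}^n$ and every $v\in V$ the vectors $f_1(a)v,\ldots,f_m(a)v\in V$ are linearly dependent over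 $\mathbb{F}$, i.e. there are $\alpha_1,\ldots,\alpha_m\in\mathbb{F}$ (possibly depending on $a$ and $v$), not all zero, with $\sum_j\alpha_j f_j(a)v=0$. A polynomial identity of $\mathcal{A}$ is a nonzero polynomial $p$ in some finite number $N$ of noncommuting variables over $\mathbb{F}$ ($N$ arbitrary, unrelated to $n$) such that $p(a)=0$ for all $a\in\mathcal{A}^N$. "$\mathcal{A}$ does not satisfy a polynomial identity of degree $\gamma$" means that no polynomial identity of $\mathcal{A}$ has degree $\gamma$. *)

theory Defs
  imports Complex_Main "HOL-Library.Poly_Mapping" "HOL-Library.FuncSet"
begin

(* Words form the free monoid under concatenation.  With this instance the
   convolution product of HOL-Library.Poly_Mapping makes finitely supported
   functions on words the free associative unital algebra. *)

instantiation list :: (type) monoid_add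
begin

definition zero_list :: "'a list" where
  "zero_list = []"

definition plus_list :: "'a list \<Rightarrow> 'a list \<Rightarrow> 'a list" where
  "plus_list = append"

instance
  by standard (simp_all add: zero_list_def plus_list_def)

end

(* The word [i, j, k] stands for the monomial X_i X_j X_k. *)

type_synonym 'a ncpoly = "nat list \<Rightarrow>\<^sub>0 'a"

definition nc_polys :: "nat \<Rightarrow> 'a::field ncpoly set" where
  "nc_polys n = {p. \<forall>w \<in> Poly_Mapping.keys p. set w \<subseteq> {1..n}}"

definition nc_scale :: "'a::field \<Rightarrow> 'a ncpoly \<Rightarrow> 'a ncpoly" where
  "nc_scale c p = Poly_Mapping.map ((*) c) p"

(* Total degree; the zero polynomial gets degree 0. *)

definition nc_degree :: "'a::field ncpoly \<Rightarrow> nat" where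
  "nc_degree p = (if p = 0 then 0 else Max (length ` Poly_Mapping.keys p))"

lemma lookup_nc_scale: "Poly_Mapping.lookup (nc_scale c p) w = c * Poly_Mapping.lookup p w"
  by (simp add: nc_scale_def Poly_Mapping.map.rep_eq when_def)

interpretation nc: vector_space nc_scale
  by standard (auto intro!: poly_mapping_eqI simp: lookup_nc_scale lookup_add algebra_simps)

lemma nc_scale_eq_mult: "nc_scale c p = Poly_Mapping.single 0 c * p"
  by (metis nc_scale_def mult_map_scale_conv_mult)

(* X_i X_j X_k is sent to the composite a_i o a_j o a_k, the empty word to id. *)

definition word_eval :: "(nat \<Rightarrow> 'v \<Rightarrow> 'v) \<Rightarrow> nat list \<Rightarrow> 'v \<Rightarrow> 'v" where
  "word_eval a w = foldr (\<lambda>i T. a i \<circ> T) w id"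

definition nc_eval ::
  "('a::field \<Rightarrow> 'v::ab_group_add \<Rightarrow> 'v) \<Rightarrow> 'a ncpoly \<Rightarrow> (nat \<Rightarrow> 'v \<Rightarrow> 'v) \<Rightarrow> 'v \<Rightarrow> 'v" where
  "nc_eval scale p a =
     (\<lambda>v. \<Sum>w \<in> Poly_Mapping.keys p. scale (Poly_Mapping.lookup p w) (word_eval a w v))"

lemma nc_eval_mult:
  assumes "vector_space scale" and lin: "\<And>i. Vector_Spaces.linear scale scale (a i)"
  shows "nc_eval scale (p * q) a = nc_eval scale p a \<circ> nc_eval scale q a"
proof -
  interpret V: vector_space scale by fact
  have sup: "nc_eval scale r a v =
      (\<Sum>w \<in> S. scale (Poly_Mapping.lookup r w) (word_eval a w v))"
    if "finite S" "Poly_Mapping.keys r \<subseteq> S" for r S v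
    unfolding nc_eval_def using that
    by (intro sum.mono_neutral_left) (auto simp: in_keys_iff)
  have add: "nc_eval scale (r + s) a v = nc_eval scale r a v + nc_eval scale s a v" for r s v
    using keys_add[of r s]
    by (simp add: sup[of "Poly_Mapping.keys r \<union> Poly_Mapping.keys s"] lookup_add
        V.scale_left_distrib sum.distrib)
  have zero: "nc_eval scale 0 a v = 0" for v
    by (simp add: nc_eval_def)
  have sng: "nc_eval scale (Poly_Mapping.single w c) a v = scale c (word_eval a w v)" for w c v
    by (simp add: sup[of "{w}"])
  have wlin: "Vector_Spaces.linear scale scale (word_eval a w)" for w
  proof (induction w)
    case Nil
    show ?case using V.linear_id by (simp add: word_eval_def id_def)
  next
    case (Cons i w)
    then show ?case
      using Vector_Spaces.linear_compose[OF Cons lin[of i]] by (simp add: word_eval_def o_def)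
  qed
  have wapp: "word_eval a (u + w) v = word_eval a u (word_eval a w v)" for u w v
    by (induction u) (simp_all add: word_eval_def plus_list_def)
  have expand: "\<exists>S c. finite S \<and> r = (\<Sum>w \<in> S. Poly_Mapping.single w (c w))"
    for r :: "'a ncpoly"
  proof -
    have "r = (\<Sum>w \<in> Poly_Mapping.keys r. Poly_Mapping.single w (Poly_Mapping.lookup r w))"
      by (rule poly_mapping_eqI)
        (auto simp: lookup_sum lookup_single when_def in_keys_iff sum.delta' if_distrib)
    then show ?thesis using finite_keys by blast
  qed
  have nsum: "nc_eval scale (\<Sum>x \<in> S. h x) a v = (\<Sum>x \<in> S. nc_eval scale (h x) a v)"
    if "finite S" for S :: "nat list set" and h v
    using that by induction (simp_all add: zero add)
  obtain S c where S: "finite S" "p = (\<Sum>w \<in> S. Poly_Mapping.single w (c w))"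
    using expand by blast
  obtain T d where T: "finite T" "q = (\<Sum>w \<in> T. Poly_Mapping.single w (d w))"
    using expand by blast
  show ?thesis
  proof
    fix v
    have "nc_eval scale (p * q) a v =
        (\<Sum>u \<in> S. \<Sum>w \<in> T. scale (c u * d w) (word_eval a u (word_eval a w v)))"
      using S T by (simp add: sum_product nsum mult_single sng wapp)
    also have "\<dots> = (nc_eval scale p a \<circ> nc_eval scale q a) v"
      using S T
      by (simp add: nsum sng
          module_hom.sum[OF Vector_Spaces.linear.axioms(3)[OF wlin]]
          module_hom.scale[OF Vector_Spaces.linear.axioms(3)[OF wlin]] V.scale_sum_right)
    finally show "nc_eval scale (p * q) a v = (nc_eval scale p a \<circ> nc_eval scale q a) v" .
  qed
qed

definition operator_algebra ::
  "('a::field \<Rightarrow> 'v::ab_group_add \<Rightarrow> 'v) \<Rightarrow> ('v \<Rightarrow> 'v) set \<Rightarrow> bool" where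
  "operator_algebra scale A \<longleftrightarrow>
     (\<forall>S \<in> A. Vector_Spaces.linear scale scale S) \<and>
     id \<in> A \<and>
     (\<forall>S \<in> A. \<forall>T \<in> A. (\<lambda>v. S v + T v) \<in> A) \<and>
     (\<forall>c. \<forall>S \<in> A. (\<lambda>v. scale c (S v)) \<in> A) \<and>
     (\<forall>S \<in> A. \<forall>T \<in> A. S \<circ> T \<in> A)"

(* Dependence of the family (x j), j in I, with repetitions counted, unlike
   the library notion of dependence, which concerns sets. *)

definition lin_dep_family ::
  "('a::field \<Rightarrow> 'v::ab_group_add \<Rightarrow> 'v) \<Rightarrow> 'i set \<Rightarrow> ('i \<Rightarrow> 'v) \<Rightarrow> bool" where
  "lin_dep_family scale I x \<longleftrightarrow>
     (\<exists>\<alpha>. (\<exists>j \<in> I. \<alpha> j \<noteq> 0) \<and> (\<Sum>j \<in> I. scale (\<alpha> j) (x j)) = 0)"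

definition locally_dir_lin_dep ::
  "('a::field \<Rightarrow> 'v::ab_group_add \<Rightarrow> 'v) \<Rightarrow> ('v \<Rightarrow> 'v) set \<Rightarrow> nat \<Rightarrow> nat \<Rightarrow>
   (nat \<Rightarrow> 'a ncpoly) \<Rightarrow> bool" where
  "locally_dir_lin_dep scale A n m f \<longleftrightarrow>
     (\<forall>a \<in> {1..n} \<rightarrow> A. \<forall>v. lin_dep_family scale {1..m} (\<lambda>j. nc_eval scale (f j) a v))"

definition polynomial_identity ::
  "('a::field \<Rightarrow> 'v::ab_group_add \<Rightarrow> 'v) \<Rightarrow> ('v \<Rightarrow> 'v) set \<Rightarrow> nat \<Rightarrow> 'a ncpoly \<Rightarrow> bool" where
  "polynomial_identity scale A N p \<longleftrightarrow>
     p \<in> nc_polys N \<and> p \<noteq> 0 \<and> (\<forall>a \<in> {1..N} \<rightarrow> A. nc_eval scale p a = (\<lambda>v. 0))"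

definition satisfies_PI_of_degree ::
  "('a::field \<Rightarrow> 'v::ab_group_add \<Rightarrow> 'v) \<Rightarrow> ('v \<Rightarrow> 'v) set \<Rightarrow> nat \<Rightarrow> bool" where
  "satisfies_PI_of_degree scale A g \<longleftrightarrow>
     (\<exists>N p. polynomial_identity scale A N p \<and> nc_degree p = g)"

end

theory Submission
  imports Defs "HOL-Combinatorics.Permutations" "HOL-Computational_Algebra.Polynomial"
begin

text \<open>
  If \<open>f\<^sub>1, \<dots>, f\<^sub>m\<close> are linearly independent, one can write down a nonzero polynomial
  of degree at most \<open>\<gamma>\<close> that vanishes on the whole algebra. It is an iterated Capelli
  polynomial. The Capelli polynomial of \<open>x\<^sub>1, \<dots>, x\<^sub>r\<close> is the signed sum over all permutations
  of the products \<open>x\<^sub>\<sigma>\<^sub>1 y\<^sub>1 x\<^sub>\<sigma>\<^sub>2 y\<^sub>2 \<dots> y\<^sub>r\<^sub>-\<^sub>1 x\<^sub>\<sigma>\<^sub>r\<close>, where the separators \<open>y\<^sub>i\<close> are fresh variables.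
  It is multilinear and alternating in the \<open>x\<^sub>i\<close>, and it does not vanish when the \<open>x\<^sub>i\<close> are
  linearly independent elements of the free algebra, because the separators keep the
  factors apart (\<open>capelli_nonzero\<close>).

  Let \<open>P\<close> be the Capelli polynomial of the \<open>f\<^sub>j\<close>. Fix an evaluation. The operators \<open>f\<^sub>j(a)\<close>
  become linearly dependent at every vector, and such a family of \<open>m\<close> operators has a
  nontrivial linear combination \<open>T\<close> of rank at most \<open>m - 1\<close> (\<open>local_dependence_rank\<close>). Over
  an infinite field this follows by moving a vector of maximal independence along generic
  lines, over a finite field by counting the vectors in the kernels of all combinations. As
  the Capelli polynomial alternates, replacing an \<open>f\<^sub>j(a)\<close> that occurs in \<open>T\<close> by \<open>T\<close> only
  multiplies \<open>P(a)\<close> by a nonzero scalar; afterwards each of the \<open>m!\<close> summands has a factor \<open>T\<close>. So \<open>P(a)\<close> has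
  rank at most \<open>d = (m - 1) m!\<close> (\<open>rank_le_capelli\<close>).

  An operator of rank at most \<open>d\<close> satisfies a nontrivial linear relation between its powers
  with exponents \<open>1, \<dots>, d + 1\<close> (\<open>powers_dependent_if_rank_le\<close>). So the Capelli polynomial
  \<open>Q\<close> of \<open>P, P\<^sup>2, \<dots>, P\<^sup>d\<^sup>+\<^sup>1\<close>, with \<open>d\<close> further fresh separators, vanishes at every evaluation.
  These powers are linearly independent in the free algebra, so \<open>Q\<close> is nonzero. The degree
  of \<open>P\<close> is at most \<open>D = m - 1 + \<Sum> deg f\<^sub>j\<close>, and that of \<open>Q\<close> at most
  \<open>(1 + 2 + \<dots> + (d + 1)) D + d = \<gamma>\<close>. Multiplying \<open>Q\<close> by a power of a variable raises the
  degree to exactly \<open>\<gamma>\<close>, as degrees add up in the free algebra.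
\<close>

section \<open>Linearly dependent families and operators of small rank\<close>

text \<open>
  Bounding the rank by the size of a spanning set of the range, and not by a dimension,
  makes the bound meaningful for operators of infinite rank, where \<open>dim\<close> returns \<open>0\<close>.
\<close>

definition rank_le :: "('a::field \<Rightarrow> 'v::ab_group_add \<Rightarrow> 'v) \<Rightarrow> ('v \<Rightarrow> 'v) \<Rightarrow> nat \<Rightarrow> bool" where
  "rank_le scale T r \<longleftrightarrow> (\<exists>B. finite B \<and> card B \<le> r \<and> range T \<subseteq> module.span scale B)"

context vector_space
begin

lemma lin_dep_familyI:
  "j \<in> I \<Longrightarrow> \<alpha> j \<noteq> 0 \<Longrightarrow> (\<Sum>j\<in>I. \<alpha> j *s x j) = 0 \<Longrightarrow> lin_dep_family scale I x"
  unfolding lin_dep_family_def by (intro exI[of _ \<alpha>]) auto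

lemma lin_dep_familyE:
  assumes "lin_dep_family scale I x"
  obtains \<alpha> j where "j \<in> I" "\<alpha> j \<noteq> 0" "(\<Sum>j\<in>I. \<alpha> j *s x j) = 0"
  using assms unfolding lin_dep_family_def by auto

lemma lin_dep_family_mono:
  assumes "lin_dep_family scale I x" "I \<subseteq> J" "finite J"
  shows "lin_dep_family scale J x"
proof -
  obtain \<alpha> j where \<alpha>: "j \<in> I" "\<alpha> j \<noteq> 0" "(\<Sum>j\<in>I. \<alpha> j *s x j) = 0"
    using assms(1) by (rule lin_dep_familyE)
  have "(\<Sum>j\<in>J. (if j \<in> I then \<alpha> j else 0) *s x j) = (\<Sum>j\<in>I. \<alpha> j *s x j)"
    using assms by (intro sum.mono_neutral_cong_right) auto
  with \<alpha> assms(2) show ?thesis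
    by (intro lin_dep_familyI[of j J "\<lambda>j. if j \<in> I then \<alpha> j else 0"]) auto
qed

lemma lin_dep_family_cong:
  assumes "\<And>i. i \<in> I \<Longrightarrow> x i = y i"
  shows "lin_dep_family scale I x \<longleftrightarrow> lin_dep_family scale I y"
  unfolding lin_dep_family_def using assms by (simp cong: sum.cong)

text \<open>
  The transfer principle between families and the library's dependence of sets.
\<close>

lemma independent_family_iff:
  assumes "finite I"
  shows "\<not> lin_dep_family scale I x \<longleftrightarrow> inj_on x I \<and> independent (x ` I)"
proof (intro iffI conjI)
  assume ind: "\<not> lin_dep_family scale I x"
  show inj: "inj_on x I"
  proof (rule inj_onI, rule ccontr)
    fix i j assume ij: "i \<in> I" "j \<in> I" "x i = x j" "i \<noteq> j"
    have "(\<Sum>k\<in>{i,j}. (if k = i then 1 else - 1) *s x k) = 0"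
      using ij by simp
    then have "lin_dep_family scale {i,j} x"
      by (intro lin_dep_familyI[of i "{i, j}" "\<lambda>k. if k = i then 1 else - 1"]) auto
    then show False
      using ind lin_dep_family_mono[of "{i,j}" x I] ij assms by auto
  qed
  show "independent (x ` I)"
  proof
    assume "dependent (x ` I)"
    then obtain u i where u: "i \<in> I" "u (x i) \<noteq> 0" "(\<Sum>v\<in>x ` I. u v *s v) = 0"
      using dependent_finite[of "x ` I"] assms by auto
    have "(\<Sum>i\<in>I. u (x i) *s x i) = 0"
      using u(3) by (simp add: sum.reindex[OF inj])
    then show False
      using u(1,2) ind lin_dep_familyI[of i I "\<lambda>i. u (x i)" x] by simp
  qed
next
  assume *: "inj_on x I \<and> independent (x ` I)"
  show "\<not> lin_dep_family scale I x"
  proof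
    assume "lin_dep_family scale I x"
    then obtain \<alpha> j where \<alpha>: "j \<in> I" "\<alpha> j \<noteq> 0" "(\<Sum>j\<in>I. \<alpha> j *s x j) = 0"
      by (rule lin_dep_familyE)
    have "(\<Sum>v\<in>x ` I. \<alpha> (inv_into I x v) *s v) = (\<Sum>j\<in>I. \<alpha> j *s x j)"
      using * by (subst sum.reindex) (auto intro!: sum.cong)
    then have "\<alpha> (inv_into I x (x j)) = 0"
      using \<alpha> * assms independentD[of "x ` I" "x ` I" "\<lambda>v. \<alpha> (inv_into I x v)" "x j"] by auto
    then show False
      using \<alpha> * by simp
  qed
qed

lemma independent_family_card_le:
  assumes "finite I" "\<not> lin_dep_family scale I x" "x ` I \<subseteq> span B" "finite B"
  shows "card I \<le> card B"
  using assms independent_family_iff[of I x] independent_span_bound[of B "x ` I"]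
  by (auto simp: card_image)

lemma lin_dep_family_insertD:
  assumes "finite K" "j \<notin> K" "\<not> lin_dep_family scale K x" "lin_dep_family scale (insert j K) x"
  obtains c where "x j = (\<Sum>i\<in>K. c i *s x i)"
proof -
  obtain \<alpha> l where \<alpha>: "l \<in> insert j K" "\<alpha> l \<noteq> 0" "(\<Sum>i\<in>insert j K. \<alpha> i *s x i) = 0"
    using assms(4) by (rule lin_dep_familyE)
  have s: "\<alpha> j *s x j + (\<Sum>i\<in>K. \<alpha> i *s x i) = 0"
    using \<alpha>(3) assms by simp
  have j: "\<alpha> j \<noteq> 0"
    using s \<alpha>(1,2) assms(3) lin_dep_familyI[of l K \<alpha> x] by auto
  have "\<alpha> j *s x j = - (\<Sum>i\<in>K. \<alpha> i *s x i)"
    using s by (simp add: eq_neg_iff_add_eq_0)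
  then have "x j = inverse (\<alpha> j) *s (- (\<Sum>i\<in>K. \<alpha> i *s x i))"
    using j by (metis left_inverse scale_one scale_scale)
  also have "\<dots> = (\<Sum>i\<in>K. (- (inverse (\<alpha> j) * \<alpha> i)) *s x i)"
    by (simp add: scale_sum_right sum_negf)
  finally show ?thesis
    by (rule that)
qed

text \<open>
  Applying \<open>g - \<mu>\<^sub>l\<close> to a linear relation removes its \<open>l\<close>-th term and scales each of the
  others by a nonzero factor.
\<close>

lemma eigenvectors_independent:
  assumes "finite L" "inj_on \<mu> L" and lin: "Vector_Spaces.linear scale scale g"
    and "\<And>l. l \<in> L \<Longrightarrow> w l \<noteq> 0" "\<And>l. l \<in> L \<Longrightarrow> g (w l) = \<mu> l *s w l"
  shows "\<not> lin_dep_family scale L w"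
  using assms(1,2,4,5)
proof (induction L)
  case empty
  then show ?case by (simp add: lin_dep_family_def)
next
  case (insert l L)
  interpret g: Vector_Spaces.linear scale scale g by fact
  show ?case
  proof
    assume "lin_dep_family scale (insert l L) w"
    then obtain \<alpha> k where \<alpha>: "k \<in> insert l L" "\<alpha> k \<noteq> 0" "(\<Sum>k\<in>insert l L. \<alpha> k *s w k) = 0"
      by (rule lin_dep_familyE)
    have s: "\<alpha> l *s w l + (\<Sum>k\<in>L. \<alpha> k *s w k) = 0"
      using \<alpha>(3) insert by simp
    have "g (\<alpha> l *s w l + (\<Sum>k\<in>L. \<alpha> k *s w k)) = 0"
      by (simp add: s g.zero)
    then have "\<alpha> l *s (\<mu> l *s w l) + (\<Sum>k\<in>L. \<alpha> k *s (\<mu> k *s w k)) = 0"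
      using insert.prems by (simp add: g.add g.scale g.sum cong: sum.cong)
    then have 1: "(\<Sum>k\<in>L. \<alpha> k *s (\<mu> k *s w k)) = - ((\<alpha> l * \<mu> l) *s w l)"
      by (simp add: eq_neg_iff_add_eq_0 add.commute)
    have "(\<Sum>k\<in>L. \<alpha> k *s w k) = - (\<alpha> l *s w l)"
      using s by (simp add: eq_neg_iff_add_eq_0 add.commute)
    then have 2: "\<mu> l *s (\<Sum>k\<in>L. \<alpha> k *s w k) = - ((\<alpha> l * \<mu> l) *s w l)"
      by (simp add: mult.commute)
    have "(\<Sum>k\<in>L. (\<alpha> k * (\<mu> k - \<mu> l)) *s w k)
        = (\<Sum>k\<in>L. \<alpha> k *s (\<mu> k *s w k)) - \<mu> l *s (\<Sum>k\<in>L. \<alpha> k *s w k)"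
      unfolding scale_sum_right sum_subtractf[symmetric]
      by (intro sum.cong) (simp_all add: right_diff_distrib scale_left_diff_distrib mult.commute)
    then have "(\<Sum>k\<in>L. (\<alpha> k * (\<mu> k - \<mu> l)) *s w k) = 0"
      unfolding 1 2 by simp
    moreover have "\<not> lin_dep_family scale L w"
      using insert by auto
    ultimately have "\<forall>k\<in>L. \<alpha> k * (\<mu> k - \<mu> l) = 0"
      by (metis lin_dep_familyI)
    moreover have "\<mu> k \<noteq> \<mu> l" if "k \<in> L" for k
      using insert.prems(1) insert.hyps(2) that by (auto simp: inj_on_def)
    ultimately have z: "\<forall>k\<in>L. \<alpha> k = 0"
      by auto
    then have "\<alpha> l *s w l = 0"
      using s by simp
    then show False
      using z \<alpha>(1,2) insert.prems(2) by auto
  qed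
qed

text \<open>
  Project onto the span of the \<open>x\<^sub>i\<close> by a map \<open>h\<close>, and let \<open>g\<close> send \<open>x\<^sub>i\<close> to \<open>h(y\<^sub>i)\<close>. A dependence
  at the parameter \<open>t\<close> yields a nonzero \<open>w\<close> in that span with \<open>w + t g(w) = 0\<close>, that is, an
  eigenvector of \<open>g\<close> with eigenvalue \<open>- 1/t\<close>. The span is finite dimensional, so there are
  only finitely many such \<open>t\<close>. This takes the place of the usual determinant argument.
\<close>

lemma finite_dependent_perturbations:
  assumes "finite I" and ind: "\<not> lin_dep_family scale I x"
  shows "finite {t. lin_dep_family scale I (\<lambda>i. x i + t *s y i)}" (is "finite ?D")
proof -
  interpret vp: vector_space_pair scale scale ..
  have x: "inj_on x I" "independent (x ` I)"
    using assms independent_family_iff by auto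
  obtain h where h: "Vector_Spaces.linear scale scale h" "\<And>b. b \<in> x ` I \<Longrightarrow> h b = b"
      "range h = span (x ` I)"
    using vp.linear_independent_extend_subspace[OF x(2), of id] by auto
  interpret h: Vector_Spaces.linear scale scale h by fact
  obtain g where g: "Vector_Spaces.linear scale scale g"
      "\<And>b. b \<in> x ` I \<Longrightarrow> g b = h (y (inv_into I x b))"
    using vp.linear_independent_extend[OF x(2), of "\<lambda>b. h (y (inv_into I x b))"] by auto
  interpret g: Vector_Spaces.linear scale scale g by fact
  have "\<forall>t\<in>?D. \<exists>\<alpha>. (\<exists>i\<in>I. \<alpha> i \<noteq> 0) \<and> (\<Sum>i\<in>I. \<alpha> i *s (x i + t *s y i)) = 0"
    by (simp add: lin_dep_family_def)
  from bchoice[OF this] obtain \<alpha> where \<alpha>': "\<forall>t\<in>?D. (\<exists>i\<in>I. \<alpha> t i \<noteq> 0) \<and> (\<Sum>i\<in>I. \<alpha> t i *s (x i + t *s y i)) = 0"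
    by (rule exE)
  then have \<alpha>: "\<And>t. t \<in> ?D \<Longrightarrow> \<exists>i\<in>I. \<alpha> t i \<noteq> 0"
      "\<And>t. t \<in> ?D \<Longrightarrow> (\<Sum>i\<in>I. \<alpha> t i *s (x i + t *s y i)) = 0"
    by simp_all
  define w where "w t = (\<Sum>i\<in>I. \<alpha> t i *s x i)" for t
  have w0: "w t \<noteq> 0" if "t \<in> ?D" for t
    using \<alpha>(1)[OF that] ind lin_dep_familyI[of _ I "\<alpha> t" x] unfolding w_def by auto
  have gw: "w t + t *s g (w t) = 0" if "t \<in> ?D" for t
  proof -
    have "g (w t) = (\<Sum>i\<in>I. \<alpha> t i *s h (y i))"
      unfolding w_def using x(1) by (simp add: g.sum g.scale g(2) cong: sum.cong)
    moreover have "h (\<Sum>i\<in>I. \<alpha> t i *s (x i + t *s y i)) = 0"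
      by (simp only: \<alpha>(2)[OF that] h.zero)
    ultimately show ?thesis
      unfolding w_def
      by (simp add: h.sum h.scale h.add h(2) scale_right_distrib sum.distrib scale_sum_right
          mult.commute cong: sum.cong)
  qed
  have t0: "t \<noteq> 0" if "t \<in> ?D" for t
    using gw[OF that] w0[OF that] by auto
  have eig: "g (w t) = (- inverse t) *s w t" if "t \<in> ?D" for t
  proof -
    have "t *s g (w t) = - w t"
      using gw[OF that] by (simp add: eq_neg_iff_add_eq_0 add.commute)
    then have "inverse t *s (t *s g (w t)) = inverse t *s (- w t)"
      by simp
    then show ?thesis
      using t0[OF that] by simp
  qed
  have "card L \<le> card (x ` I)" if L: "L \<subseteq> ?D" "finite L" for L
  proof (rule independent_family_card_le)
    show "\<not> lin_dep_family scale L w"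
      using L w0 eig t0 by (intro eigenvectors_independent[where \<mu> = "\<lambda>t. - inverse t" and g = g])
        (auto simp: inj_on_def g(1))
    show "w ` L \<subseteq> span (x ` I)"
      unfolding w_def by (auto intro!: span_sum span_scale intro: span_base)
  qed (use assms L in auto)
  then show ?thesis
    using finite_if_finite_subsets_card_bdd by blast
qed

lemma rank_le_zero_operator: "rank_le scale (\<lambda>v. 0) r"
  unfolding rank_le_def by (intro exI[of _ "{}"]) auto

lemma rank_le_add:
  assumes "rank_le scale S r" "rank_le scale T s"
  shows "rank_le scale (\<lambda>v. S v + T v) (r + s)"
proof -
  obtain B C where B: "finite B" "card B \<le> r" "range S \<subseteq> span B"
    and C: "finite C" "card C \<le> s" "range T \<subseteq> span C"
    using assms unfolding rank_le_def by blast
  have "card (B \<union> C) \<le> r + s"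
    using card_Un_le[of B C] B C by linarith
  moreover have "range (\<lambda>v. S v + T v) \<subseteq> span (B \<union> C)"
    using B C span_mono[of B "B \<union> C"] span_mono[of C "B \<union> C"] by (auto intro!: span_add)
  ultimately show ?thesis
    unfolding rank_le_def using B C by (intro exI[of _ "B \<union> C"]) auto
qed

lemma rank_le_sum:
  assumes "finite S" "\<And>s. s \<in> S \<Longrightarrow> rank_le scale (T s) r"
  shows "rank_le scale (\<lambda>v. \<Sum>s\<in>S. T s v) (card S * r)"
  using assms by (induction S) (auto simp: rank_le_zero_operator intro!: rank_le_add)

lemma rank_le_compose:
  assumes "Vector_Spaces.linear scale scale L" "rank_le scale T r"
  shows "rank_le scale (L \<circ> T \<circ> R) r"
proof -
  obtain B where B: "finite B" "card B \<le> r" "range T \<subseteq> span B"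
    using assms unfolding rank_le_def by blast
  interpret L: Vector_Spaces.linear scale scale L by fact
  have "card (L ` B) \<le> r"
    using card_image_le[OF B(1), of L] B by linarith
  moreover have "range (L \<circ> T \<circ> R) \<subseteq> span (L ` B)"
    using B by (auto simp: L.span_image)
  ultimately show ?thesis
    unfolding rank_le_def using B by blast
qed

section \<open>Locally dependent operators\<close>

text \<open>
  Choose a vector \<open>v\<close> and a maximal \<open>K\<close> such that the \<open>T\<^sub>i v\<close> with \<open>i \<in> K\<close> are independent. For
  \<open>j \<notin> K\<close>, a linear combination \<open>S\<close> of \<open>T\<^sub>j\<close> and the \<open>T\<^sub>i\<close> kills \<open>v\<close>. Its range lies in
  the span of the \<open>T\<^sub>i v\<close>: if \<open>S u\<close> were outside, then moving from \<open>v\<close> to \<open>v + t u\<close> for a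
  suitable \<open>t \<noteq> 0\<close> would keep the \<open>T\<^sub>i\<close> independent together with \<open>S\<close>, contradicting the
  maximality of \<open>K\<close>. An infinite field provides such a \<open>t\<close>.
\<close>

lemma local_dependence_rank_infinite:
  assumes "infinite (UNIV :: 'a set)" "finite J"
    and lin: "\<And>j. j \<in> J \<Longrightarrow> Vector_Spaces.linear scale scale (T j)"
    and dep: "\<And>v. lin_dep_family scale J (\<lambda>j. T j v)"
  shows "\<exists>\<alpha>. (\<exists>j\<in>J. \<alpha> j \<noteq> 0) \<and> rank_le scale (\<lambda>v. \<Sum>j\<in>J. \<alpha> j *s T j v) (card J - 1)"
proof -
  define R where "R = {K. K \<subseteq> J \<and> (\<exists>v. \<not> lin_dep_family scale K (\<lambda>j. T j v))}"
  have "finite R"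
    by (rule finite_subset[of _ "Pow J"]) (use assms(2) in \<open>auto simp: R_def\<close>)
  moreover have "{} \<in> R"
    by (auto simp: R_def lin_dep_family_def)
  ultimately obtain K where K: "K \<in> R" "\<And>K'. K' \<in> R \<Longrightarrow> K \<subseteq> K' \<Longrightarrow> K = K'"
    using finite_has_maximal[of R] by blast
  then obtain v where v: "K \<subseteq> J" "\<not> lin_dep_family scale K (\<lambda>j. T j v)"
    unfolding R_def by blast
  then have "K \<noteq> J"
    using dep[of v] by auto
  then obtain j where j: "j \<in> J" "j \<notin> K"
    using v(1) by auto
  have finK: "finite K"
    using v assms(2) finite_subset by blast
  have depj: "lin_dep_family scale (insert j K) (\<lambda>i. T i u)" for u
  proof (rule ccontr)
    assume "\<not> ?thesis"
    then have "insert j K \<in> R"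
      using j v unfolding R_def by blast
    then show False
      using K(2) j by blast
  qed
  obtain c where c: "T j v = (\<Sum>i\<in>K. c i *s T i v)"
    using lin_dep_family_insertD[OF finK j(2) v(2) depj] by blast
  \<comment> \<open>Maximality of \<open>K\<close> expresses \<open>T j v\<close> by the \<open>T i v\<close>; \<open>S\<close> is the combination that kills \<open>v\<close>.\<close>
  define S where "S u = T j u - (\<Sum>i\<in>K. c i *s T i u)" for u
  have lini: "T i (a + t *s b) = T i a + t *s T i b" if "i \<in> J" for i a t b
  proof -
    interpret Vector_Spaces.linear scale scale "T i" using lin that .
    show ?thesis by (simp add: add scale)
  qed
  have S_lin: "S (v + t *s u) = t *s S u" for t u
  proof -
    have "(\<Sum>i\<in>K. c i *s T i (v + t *s u)) = (\<Sum>i\<in>K. c i *s T i v) + t *s (\<Sum>i\<in>K. c i *s T i u)"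
      using v(1) by (simp add: lini subset_iff scale_right_distrib sum.distrib scale_sum_right
          mult.commute cong: sum.cong)
    then show ?thesis
      unfolding S_def using lini[OF j(1)] c by (simp add: scale_right_diff_distrib)
  qed
  have S_in: "S u \<in> span ((\<lambda>i. T i v) ` K)" for u
  proof (rule ccontr)
    assume notin: "S u \<notin> span ((\<lambda>i. T i v) ` K)"
    \<comment> \<open>The vector \<open>S (v + t *s u) = t *s S u\<close> keeps its direction, so \<open>S u\<close> itself is not perturbed.\<close>
    define x where "x i = (if i = j then S u else T i v)" for i
    define y where "y i = (if i = j then 0 else T i u)" for i
    have xK: "x i = T i v" if "i \<in> K" for i
      using that j by (auto simp: x_def)
    have indx: "\<not> lin_dep_family scale (insert j K) x"
    proof
      assume d: "lin_dep_family scale (insert j K) x"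
      have "\<not> lin_dep_family scale K x"
        using v(2) lin_dep_family_cong[of K x "\<lambda>i. T i v"] xK by blast
      then obtain e where "x j = (\<Sum>i\<in>K. e i *s x i)"
        using lin_dep_family_insertD[OF finK j(2) _ d] by blast
      then have "S u = (\<Sum>i\<in>K. e i *s T i v)"
        by (simp add: x_def xK[unfolded x_def] cong: sum.cong)
      then have "S u \<in> span ((\<lambda>i. T i v) ` K)"
        by (auto intro!: span_sum span_scale intro: span_base)
      then show False
        using notin by blast
    qed
    \<comment> \<open>The value \<open>t = 0\<close> must be avoided too: there \<open>S\<close> vanishes.\<close>
    have "finite ({0} \<union> {t. lin_dep_family scale (insert j K) (\<lambda>i. x i + t *s y i)})"
      using finite_dependent_perturbations[OF _ indx] finK by simp
    then obtain t where t: "t \<noteq> 0" "\<not> lin_dep_family scale (insert j K) (\<lambda>i. x i + t *s y i)"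
      using assms(1) ex_new_if_finite[of "{0} \<union> {t. lin_dep_family scale (insert j K) (\<lambda>i. x i + t *s y i)}"]
      by auto
    let ?v = "v + t *s u"
    have xyK: "x i + t *s y i = T i ?v" if "i \<in> K" for i
      using that j v lini by (auto simp: x_def y_def)
    have "\<not> lin_dep_family scale K (\<lambda>i. T i ?v)"
      using t(2) lin_dep_family_mono[of K _ "insert j K"] finK
        lin_dep_family_cong[of K "\<lambda>i. x i + t *s y i" "\<lambda>i. T i ?v"] xyK by blast
    then obtain e where e: "T j ?v = (\<Sum>i\<in>K. e i *s T i ?v)"
      using lin_dep_family_insertD[OF finK j(2) _ depj] by blast
    have "t *s S u = (\<Sum>i\<in>K. (e i - c i) *s T i ?v)"
      using S_lin[of t u] e by (simp add: S_def sum_subtractf scale_left_diff_distrib)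
    also have "\<dots> = - (\<Sum>i\<in>K. (if i = j then t else c i - e i) *s (x i + t *s y i))"
      unfolding sum_negf[symmetric] using j(2) xyK
      by (intro sum.cong) (auto simp: scale_left_diff_distrib)
    finally have "(\<Sum>i\<in>insert j K. (if i = j then t else c i - e i) *s (x i + t *s y i)) = 0"
      using finK j(2) by (simp add: x_def[of j] y_def[of j])
    then have "lin_dep_family scale (insert j K) (\<lambda>i. x i + t *s y i)"
      using t(1) by (intro lin_dep_familyI[of j _ "\<lambda>i. if i = j then t else c i - e i"]) auto
    then show False
      using t by blast
  qed
  define \<alpha> where "\<alpha> i = (if i = j then 1 else if i \<in> K then - c i else 0)" for i
  have "(\<Sum>i\<in>J. \<alpha> i *s T i u) = S u" for u
  proof -
    have "(\<Sum>i\<in>J. \<alpha> i *s T i u) = (\<Sum>i\<in>insert j K. \<alpha> i *s T i u)"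
      using j v assms(2) by (intro sum.mono_neutral_right) (auto simp: \<alpha>_def)
    also have "\<dots> = T j u + (\<Sum>i\<in>K. \<alpha> i *s T i u)"
      using finK j by (simp add: \<alpha>_def)
    also have "(\<Sum>i\<in>K. \<alpha> i *s T i u) = - (\<Sum>i\<in>K. c i *s T i u)"
      unfolding sum_negf[symmetric] using j by (intro sum.cong) (auto simp: \<alpha>_def)
    finally show ?thesis
      by (simp add: S_def)
  qed
  moreover have "rank_le scale S (card J - 1)"
  proof -
    have "card ((\<lambda>i. T i v) ` K) \<le> card K"
      using finK card_image_le by blast
    also have "card K < card J"
      using v(1) j assms(2) by (intro psubset_card_mono) auto
    finally show ?thesis
      unfolding rank_le_def using finK S_in by (intro exI[of _ "(\<lambda>i. T i v) ` K"]) auto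
  qed
  moreover have "\<alpha> j \<noteq> 0"
    by (simp add: \<alpha>_def)
  ultimately show ?thesis
    using j(1) by (intro exI[of _ \<alpha>]) auto
qed

text \<open>
  A rank of at least \<open>r + 1\<close> is witnessed by finitely many vectors, also when it is infinite.
\<close>

lemma independent_values_if_not_rank_le:
  assumes lin: "Vector_Spaces.linear scale scale T" and "\<not> rank_le scale T r"
  shows "\<exists>u. \<not> lin_dep_family scale {..r} (\<lambda>i. T (u i))"
proof -
  obtain B where B: "B \<subseteq> range T" "independent B" "range T \<subseteq> span B"
    by (rule basis_exists[of "range T"])
  have "\<exists>C\<subseteq>B. finite C \<and> card C = Suc r"
  proof (cases "finite B")
    case True
    then have "Suc r \<le> card B"
      using assms(2) B unfolding rank_le_def by (meson not_less_eq_eq)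
    then show ?thesis
      using True by (meson obtain_subset_with_card_n finite_subset)
  next
    case False
    then show ?thesis
      using infinite_arbitrarily_large by blast
  qed
  then obtain C where C: "C \<subseteq> B" "finite C" "card C = Suc r" by blast
  have "\<exists>h. bij_betw h {..r} C"
    using C by (intro finite_same_card_bij) auto
  then obtain h where h: "bij_betw h {..r} C" by blast
  define u where "u i = (SOME v. T v = h i)" for i
  have Tu: "T (u i) = h i" if "i \<le> r" for i
  proof -
    have "h i \<in> range T"
      using h that C B by (auto simp: bij_betw_def)
    then show ?thesis
      unfolding u_def by (metis (mono_tags, lifting) rangeE someI)
  qed
  have "\<not> lin_dep_family scale {..r} h"
    using h C(1) B(2) independent_mono by (auto simp: independent_family_iff bij_betw_def)
  then show ?thesis
    using Tu lin_dep_family_cong[of "{..r}" "\<lambda>i. T (u i)" h] by auto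
qed

text \<open>
  Adding to a kernel element an arbitrary combination of the \<open>u\<^sub>i\<close> is injective, since \<open>T\<close>
  recovers the coefficients.
\<close>

lemma card_kernel_le:
  assumes "finite (UNIV :: 'a set)" "subspace W" "finite W" and lin: "Vector_Spaces.linear scale scale T"
    and ind: "\<not> lin_dep_family scale {..r} (\<lambda>i. T (u i))" and u: "u ` {..r} \<subseteq> W"
  shows "card {v \<in> W. T v = 0} * card (UNIV :: 'a set) ^ Suc r \<le> card W"
proof -
  interpret T: Vector_Spaces.linear scale scale T by fact
  let ?C = "{..r} \<rightarrow>\<^sub>E (UNIV :: 'a set)"
  let ?K = "{v \<in> W. T v = 0}"
  have "inj_on (\<lambda>(k, c). k + (\<Sum>i\<le>r. c i *s u i)) (?K \<times> ?C)"
  proof (rule inj_onI, clarify)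
    fix k c k' c' assume A: "c \<in> ?C" "c' \<in> ?C" "T k = 0" "T k' = 0"
      and eq: "k + (\<Sum>i\<le>r. c i *s u i) = k' + (\<Sum>i\<le>r. c' i *s u i)"
    have "T (k + (\<Sum>i\<le>r. c i *s u i)) = T (k' + (\<Sum>i\<le>r. c' i *s u i))"
      by (simp add: eq)
    then have "(\<Sum>i\<le>r. (c i - c' i) *s T (u i)) = 0"
      using A by (simp add: T.add T.sum T.scale scale_left_diff_distrib sum_subtractf)
    then have "\<forall>i\<le>r. c i - c' i = 0"
      using ind lin_dep_familyI[of _ "{..r}" "\<lambda>i. c i - c' i" "\<lambda>i. T (u i)"] by auto
    then have "c = c'"
      using A by (intro PiE_ext[of c "{..r}" _ c']) auto
    then show "k = k' \<and> c = c'"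
      using eq by auto
  qed
  moreover have "(\<lambda>(k, c). k + (\<Sum>i\<le>r. c i *s u i)) ` (?K \<times> ?C) \<subseteq> W"
    using assms(2) u by (auto intro!: subspace_add subspace_sum subspace_scale)
  ultimately have "card (?K \<times> ?C) \<le> card W"
    using assms(3) card_inj_on_le by blast
  then show ?thesis
    using assms(1) by (simp add: card_cartesian_product card_PiE)
qed

text \<open>
  A counting argument replaces the choice of a generic scalar. Local dependence says that
  the kernels of the \<open>q\<^sup>m - 1\<close> nontrivial combinations cover the space. If all combinations
  had rank at least \<open>m\<close>, then this would be visible on a finite subspace \<open>W\<close>, in which
  each kernel takes up at most the fraction \<open>1/q\<^sup>m\<close>; so they could not cover \<open>W\<close>.
\<close>

lemma local_dependence_rank_finite:
  assumes fin: "finite (UNIV :: 'a set)" "finite J" "J \<noteq> {}"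
    and lin: "\<And>j. j \<in> J \<Longrightarrow> Vector_Spaces.linear scale scale (T j)"
    and dep: "\<And>v. lin_dep_family scale J (\<lambda>j. T j v)"
  shows "\<exists>\<alpha>. (\<exists>j\<in>J. \<alpha> j \<noteq> 0) \<and> rank_le scale (\<lambda>v. \<Sum>j\<in>J. \<alpha> j *s T j v) (card J - 1)"
proof (rule ccontr)
  assume no: "\<not> ?thesis"
  define r where "r = card J - 1"
  have card: "card J = Suc r"
    using fin by (simp add: r_def card_gt_0_iff)
  define S where "S \<alpha> v = (\<Sum>j\<in>J. \<alpha> j *s T j v)" for \<alpha> v
  define N where "N = (J \<rightarrow>\<^sub>E (UNIV :: 'a set)) - {\<lambda>j\<in>J. 0}"
  have finN: "finite N"
    using fin by (auto simp: N_def intro: finite_PiE)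
  have Slin: "Vector_Spaces.linear scale scale (S \<alpha>)" for \<alpha>
  proof -
    have "T j (a + b) = T j a + T j b" "T j (c *s a) = c *s T j a" if "j \<in> J" for j a b c
    proof -
      interpret Vector_Spaces.linear scale scale "T j" using lin that .
      show "T j (a + b) = T j a + T j b" "T j (c *s a) = c *s T j a" by (simp_all add: add scale)
    qed
    then show ?thesis
      unfolding S_def
      by unfold_locales (simp_all add: scale_right_distrib sum.distrib scale_sum_right mult.commute cong: sum.cong)
  qed
  have "\<exists>u. \<not> lin_dep_family scale {..r} (\<lambda>i. S \<alpha> (u i))" if "\<alpha> \<in> N" for \<alpha>
  proof (rule independent_values_if_not_rank_le[OF Slin])
    have "\<exists>j\<in>J. \<alpha> j \<noteq> 0"
    proof (rule ccontr)
      assume "\<not> (\<exists>j\<in>J. \<alpha> j \<noteq> 0)"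
      then have "\<alpha> = (\<lambda>j\<in>J. 0)"
        using that by (intro PiE_ext[of \<alpha> J "\<lambda>_. UNIV" "\<lambda>j\<in>J. 0"]) (auto simp: N_def)
      then show False using that by (simp add: N_def)
    qed
    then show "\<not> rank_le scale (S \<alpha>) r"
      using no unfolding r_def S_def by blast
  qed
  then obtain u where u: "\<And>\<alpha>. \<alpha> \<in> N \<Longrightarrow> \<not> lin_dep_family scale {..r} (\<lambda>i. S \<alpha> (u \<alpha> i))"
    by metis
  \<comment> \<open>The span of \<open>G\<close> is finite and still contains \<open>r + 1\<close> witnesses for the rank of each combination.\<close>
  define G where "G = (\<Union>\<alpha>\<in>N. u \<alpha> ` {..r})"
  define W where "W = span G"
  have "finite G"
    using finN by (simp add: G_def)
  have finW: "finite W"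
  proof -
    have "W = (\<lambda>c. \<Sum>v\<in>G. c v *s v) ` (G \<rightarrow>\<^sub>E UNIV)"
    proof -
      have "(\<Sum>v\<in>G. c v *s v) \<in> (\<lambda>c. \<Sum>v\<in>G. c v *s v) ` (G \<rightarrow>\<^sub>E UNIV)" for c
        by (rule image_eqI[of _ _ "restrict c G"]) auto
      then show ?thesis
        unfolding W_def span_finite[OF \<open>finite G\<close>] by auto
    qed
    then show ?thesis
      using \<open>finite G\<close> fin by (simp add: finite_PiE)
  qed
  have cover: "W \<subseteq> (\<Union>\<alpha>\<in>N. {v \<in> W. S \<alpha> v = 0})"
  proof
    fix v assume v: "v \<in> W"
    obtain \<alpha> l where \<alpha>: "l \<in> J" "\<alpha> l \<noteq> 0" "(\<Sum>j\<in>J. \<alpha> j *s T j v) = 0"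
      using dep[of v] by (rule lin_dep_familyE)
    have "restrict \<alpha> J \<in> N"
      using \<alpha>(1,2) by (auto simp: N_def restrict_def fun_eq_iff)
    moreover have "S (restrict \<alpha> J) v = 0"
      using \<alpha>(3) by (simp add: S_def)
    ultimately show "v \<in> (\<Union>\<alpha>\<in>N. {v \<in> W. S \<alpha> v = 0})"
      using v by blast
  qed
  let ?q = "card (UNIV :: 'a set) ^ Suc r"
  have "card W \<le> card (\<Union>\<alpha>\<in>N. {v \<in> W. S \<alpha> v = 0})"
    by (rule card_mono[OF _ cover]) (rule finite_subset[OF _ finW], blast)
  also have "\<dots> \<le> (\<Sum>\<alpha>\<in>N. card {v \<in> W. S \<alpha> v = 0})"
    by (rule card_UN_le[OF finN])
  finally have "card W \<le> (\<Sum>\<alpha>\<in>N. card {v \<in> W. S \<alpha> v = 0})" .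
  then have "card W * ?q \<le> (\<Sum>\<alpha>\<in>N. card {v \<in> W. S \<alpha> v = 0} * ?q)"
    by (simp only: sum_distrib_right[symmetric] mult_le_mono1)
  also have "\<dots> \<le> (\<Sum>\<alpha>\<in>N. card W)"
  proof (rule sum_mono)
    fix \<alpha> assume "\<alpha> \<in> N"
    then show "card {v \<in> W. S \<alpha> v = 0} * ?q \<le> card W"
      using u finW fin Slin
      by (intro card_kernel_le[where u = "u \<alpha>"]) (auto simp: W_def G_def intro!: span_base)
  qed
  also have "\<dots> = card N * card W"
    by simp
  also have "card N = ?q - 1"
    using fin card by (simp add: N_def card_Diff_singleton card_PiE)
  finally have "card W * ?q \<le> (?q - 1) * card W" .
  moreover have "card W > 0"
    using finW by (auto simp: card_gt_0_iff W_def intro: span_zero)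
  moreover have "?q > 0"
    using fin by (simp add: card_gt_0_iff)
  ultimately show False
    by (cases ?q) (auto simp: mult.commute)
qed

lemma local_dependence_rank:
  assumes "finite J" "J \<noteq> {}"
    and "\<And>j. j \<in> J \<Longrightarrow> Vector_Spaces.linear scale scale (T j)"
    and "\<And>v. lin_dep_family scale J (\<lambda>j. T j v)"
  shows "\<exists>\<alpha>. (\<exists>j\<in>J. \<alpha> j \<noteq> 0) \<and> rank_le scale (\<lambda>v. \<Sum>j\<in>J. \<alpha> j *s T j v) (card J - 1)"
  using assms local_dependence_rank_finite local_dependence_rank_infinite by (cases "finite (UNIV :: 'a set)") blast+

end

section \<open>Linear relations between powers of an operator of small rank\<close>

text \<open>
  The value \<open>p(T)\<close>. Operators are plain functions and form no type-class ring, so \<open>poly\<close> is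
  not applicable.
\<close>

definition op_poly ::
  "('a::field \<Rightarrow> 'v::ab_group_add \<Rightarrow> 'v) \<Rightarrow> ('v \<Rightarrow> 'v) \<Rightarrow> 'a poly \<Rightarrow> 'v \<Rightarrow> 'v" where
  "op_poly scale T p v = (\<Sum>i\<le>degree p. scale (coeff p i) ((T ^^ i) v))"

context vector_space
begin

lemma op_poly_bound:
  assumes "degree p \<le> N"
  shows "op_poly scale T p v = (\<Sum>i\<le>N. coeff p i *s (T ^^ i) v)"
  unfolding op_poly_def using assms
  by (intro sum.mono_neutral_left) (auto simp: coeff_eq_0)

lemma op_poly_add: "op_poly scale T (p + q) v = op_poly scale T p v + op_poly scale T q v"
proof -
  let ?N = "max (degree p) (degree q)"
  have "op_poly scale T r v = (\<Sum>i\<le>?N. coeff r i *s (T ^^ i) v)"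
    if "r \<in> {p, q, p + q}" for r
    using that degree_add_le_max[of p q] by (intro op_poly_bound) auto
  then show ?thesis
    by (simp add: scale_left_distrib sum.distrib)
qed

lemma op_poly_smult: "op_poly scale T (smult c p) v = c *s op_poly scale T p v"
  using op_poly_bound[of "smult c p" "degree p" T v] degree_smult_le[of c p]
  by (simp add: op_poly_def scale_sum_right)

lemma op_poly_shift: "op_poly scale T (pCons 0 p) v = op_poly scale T p (T v)"
proof -
  have "op_poly scale T (pCons 0 p) v = (\<Sum>i\<le>Suc (degree p). coeff (pCons 0 p) i *s (T ^^ i) v)"
    by (intro op_poly_bound) (rule degree_pCons_le)
  also have "\<dots> = op_poly scale T p (T v)"
    unfolding sum.atMost_Suc_shift by (simp add: op_poly_def funpow_swap1)
  finally show ?thesis .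
qed

lemma linear_funpow:
  assumes "Vector_Spaces.linear scale scale T"
  shows "Vector_Spaces.linear scale scale (T ^^ i)"
proof (induction i)
  case 0
  show ?case using linear_id by (simp add: id_def)
next
  case (Suc i)
  show ?case
    using Vector_Spaces.linear_compose[OF Suc assms] by (simp add: comp_def)
qed

lemma linear_op_poly:
  assumes "Vector_Spaces.linear scale scale T"
  shows "Vector_Spaces.linear scale scale (op_poly scale T p)"
proof -
  have "(T ^^ i) (a + b) = (T ^^ i) a + (T ^^ i) b" "(T ^^ i) (c *s a) = c *s (T ^^ i) a" for i a b c
  proof -
    interpret Vector_Spaces.linear scale scale "T ^^ i" using linear_funpow[OF assms] .
    show "(T ^^ i) (a + b) = (T ^^ i) a + (T ^^ i) b" "(T ^^ i) (c *s a) = c *s (T ^^ i) a"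
      by (simp_all add: add scale)
  qed
  then show ?thesis
    unfolding op_poly_def
    by unfold_locales (simp_all add: scale_right_distrib sum.distrib scale_sum_right mult.commute)
qed

lemma op_poly_commute:
  assumes "Vector_Spaces.linear scale scale M" "\<And>v. T (M v) = M (T v)"
  shows "op_poly scale T p (M v) = M (op_poly scale T p v)"
proof -
  interpret M: Vector_Spaces.linear scale scale M by fact
  have "(T ^^ i) (M v) = M ((T ^^ i) v)" for i
    by (induction i) (simp_all add: assms(2))
  then show ?thesis
    by (simp add: op_poly_def M.sum M.scale)
qed

lemma op_poly_mult:
  assumes "Vector_Spaces.linear scale scale T"
  shows "op_poly scale T (p * q) v = op_poly scale T p (op_poly scale T q v)"
proof (induction p arbitrary: v)
  case 0
  show ?case by (simp add: op_poly_def)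
next
  case (pCons a p)
  have 1: "op_poly scale T (pCons a r) u = a *s u + op_poly scale T r (T u)" for r u
    using op_poly_add[of T "[:a:]" "pCons 0 r" u] op_poly_shift[of T r u]
    by (simp add: op_poly_def[of _ _ "[:a:]"])
  have 2: "op_poly scale T q (T v) = T (op_poly scale T q v)"
    by (rule op_poly_commute[OF assms]) (rule refl)
  show ?case
    by (simp add: op_poly_add op_poly_smult op_poly_shift 1 2 pCons.IH)
qed

text \<open>
  This is the bound of the degree of the minimal polynomial by the dimension, for the
  restriction of \<open>T\<close> to the range of \<open>M\<close>. Working with ranges of operators that commute with
  \<open>T\<close> makes the induction go through without quotient spaces: if \<open>w = M v \<noteq> 0\<close> generates a
  cyclic subspace of dimension \<open>k\<close>, then some \<open>p\<close> of degree at most \<open>k\<close> has \<open>p(T) w = 0\<close>,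
  hence \<open>p(T)\<close> kills a \<open>k\<close>-dimensional part of the range and \<open>p(T) \<circ> M\<close> has rank at most
  \<open>r - k\<close>.
\<close>

lemma annihilating_poly_on_range:
  assumes T: "Vector_Spaces.linear scale scale T"
    and "Vector_Spaces.linear scale scale M" "\<And>v. T (M v) = M (T v)" "rank_le scale M r"
  shows "\<exists>p. p \<noteq> 0 \<and> degree p \<le> r \<and> (\<forall>v. op_poly scale T p (M v) = 0)"
  using assms(2-)
proof (induction r arbitrary: M rule: less_induct)
  case (less r M)
  interpret M: Vector_Spaces.linear scale scale M by fact
  show ?case
  proof (cases "\<forall>v. M v = 0")
    case True
    then show ?thesis
      by (intro exI[of _ 1]) (simp add: op_poly_def)
  next
    case False
    then obtain v where v: "M v \<noteq> 0" by auto
    define x where "x i = (T ^^ i) (M v)" for i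
    have x_range: "x i \<in> range M" for i
      unfolding x_def by (induction i) (auto simp: less.prems(2))
    obtain C where C: "finite C" "card C \<le> r" "range M \<subseteq> span C"
      using less.prems(3) unfolding rank_le_def by auto
    \<comment> \<open>The cyclic subspace of \<open>M v\<close> is spanned by \<open>x 0, \<dots>, x (k - 1)\<close>.\<close>
    define k where "k = (LEAST k. lin_dep_family scale {..k} x)"
    have "lin_dep_family scale {..r} x"
    proof (rule ccontr)
      assume "\<not> lin_dep_family scale {..r} x"
      then have "card {..r} \<le> card C"
        using C x_range by (intro independent_family_card_le) auto
      then show False
        using C by simp
    qed
    then have dep: "lin_dep_family scale {..k} x"
      unfolding k_def by (rule LeastI)
    have k0: "k > 0"
    proof (rule ccontr)
      assume "\<not> k > 0"
      then show False
        using dep v by (auto simp: lin_dep_family_def x_def)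
    qed
    have ind: "\<not> lin_dep_family scale {..<k} x"
    proof -
      have "{..<k} = {..k - 1}"
        using k0 by auto
      moreover have "\<not> lin_dep_family scale {..k - 1} x"
        using k0 unfolding k_def by (intro not_less_Least) simp
      ultimately show ?thesis by simp
    qed
    obtain \<alpha> j where \<alpha>: "j \<in> {..k}" "\<alpha> j \<noteq> 0" "(\<Sum>i\<in>{..k}. \<alpha> i *s x i) = 0"
      using dep by (rule lin_dep_familyE)
    define p where "p = (\<Sum>i\<le>k. monom (\<alpha> i) i)"
    have coeff_p: "coeff p i = (if i \<le> k then \<alpha> i else 0)" for i
      by (simp add: p_def coeff_sum sum.delta')
    have "p \<noteq> 0"
      using \<alpha> coeff_p[of j] by auto
    have deg_p: "degree p \<le> k"
      by (rule degree_le) (simp add: coeff_p)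
    have p_kills: "op_poly scale T p (M v) = 0"
      using \<alpha>(3) by (simp add: op_poly_bound[OF deg_p] coeff_p x_def)
    interpret p: Vector_Spaces.linear scale scale "op_poly scale T p"
      by (rule linear_op_poly[OF T])
    have p_kills_x: "op_poly scale T p (x i) = 0" for i
    proof -
      interpret Ti: Vector_Spaces.linear scale scale "T ^^ i"
        by (rule linear_funpow[OF T])
      have "T ((T ^^ i) u) = (T ^^ i) (T u)" for u
        by (simp add: funpow_swap1)
      then show ?thesis
        unfolding x_def using op_poly_commute[OF linear_funpow[OF T], of T i p "M v"] p_kills
        by (simp add: Ti.zero)
    qed
    have x: "inj_on x {..<k}" "independent (x ` {..<k})"
      using ind independent_family_iff[of "{..<k}" x] by auto
    \<comment> \<open>A basis of the range of \<open>M\<close> whose first \<open>k\<close> elements are killed by \<open>p(T)\<close>.\<close>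
    obtain B where B: "x ` {..<k} \<subseteq> B" "B \<subseteq> range M" "independent B" "range M \<subseteq> span B"
      by (rule maximal_independent_subset_extend[OF _ x(2), of "range M"]) (use x_range in auto)
    have cardB: "finite B" "card B \<le> r"
      using independent_span_bound[OF C(1) B(3) subset_trans[OF B(2) C(3)]] C(2) by auto
    have card_k: "card (x ` {..<k}) = k"
      using x by (simp add: card_image)
    then have "k \<le> r"
      using card_mono[OF cardB(1) B(1)] cardB by simp
    define M' where "M' = op_poly scale T p \<circ> M"
    define B' where "B' = op_poly scale T p ` (B - x ` {..<k})"
    have "card B' \<le> r - k"
      using card_image_le[of "B - x ` {..<k}" "op_poly scale T p"] cardB card_k B(1)
      by (auto simp: B'_def card_Diff_subset)
    moreover have "range M' \<subseteq> span B'"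
    proof -
      have "op_poly scale T p ` B \<subseteq> span B'"
      proof
        fix w assume "w \<in> op_poly scale T p ` B"
        then obtain b where b: "b \<in> B" "w = op_poly scale T p b" by blast
        show "w \<in> span B'"
        proof (cases "b \<in> x ` {..<k}")
          case True
          then show ?thesis
            using b p_kills_x by (auto simp: span_zero)
        next
          case False
          then show ?thesis
            using b by (auto simp: B'_def intro: span_base)
        qed
      qed
      then have "span (op_poly scale T p ` B) \<subseteq> span B'"
        by (rule span_minimal) simp
      then show ?thesis
        using B(4) unfolding p.span_image M'_def by auto
    qed
    ultimately have rank': "rank_le scale M' (r - k)"
      unfolding rank_le_def using cardB by (intro exI[of _ B']) (auto simp: B'_def)
    have "Vector_Spaces.linear scale scale M'"
      unfolding M'_def by (rule Vector_Spaces.linear_compose) (fact less.prems(1), rule linear_op_poly[OF T])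
    moreover have "T (M' u) = M' (T u)" for u
      using op_poly_commute[where M = T and T = T and p = p, OF T] less.prems(2)[symmetric] by (simp add: M'_def)
    ultimately obtain q where q: "q \<noteq> 0" "degree q \<le> r - k" "\<forall>v. op_poly scale T q (M' v) = 0"
      using less.IH[of "r - k" M'] rank' k0 \<open>k \<le> r\<close> by auto
    have "degree (q * p) \<le> r"
      using degree_mult_le[of q p] q deg_p \<open>k \<le> r\<close> by linarith
    then show ?thesis
      using q \<open>p \<noteq> 0\<close> by (intro exI[of _ "q * p"]) (simp add: op_poly_mult[OF T] M'_def)
  qed
qed

lemma powers_dependent_if_rank_le:
  assumes T: "Vector_Spaces.linear scale scale T" and "rank_le scale T r"
  shows "\<exists>\<alpha>. (\<exists>i\<le>r. \<alpha> i \<noteq> 0) \<and> (\<forall>v. (\<Sum>i\<le>r. \<alpha> i *s (T ^^ Suc i) v) = 0)"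
proof -
  obtain p where p: "p \<noteq> 0" "degree p \<le> r" "\<forall>v. op_poly scale T p (T v) = 0"
    using annihilating_poly_on_range[where M = T, OF T T _ assms(2)] by auto
  have "(\<Sum>i\<le>r. coeff p i *s (T ^^ Suc i) v) = 0" for v
    using p(3) op_poly_bound[OF p(2), of T "T v"] by (simp add: funpow_swap1)
  moreover have "\<exists>i\<le>r. coeff p i \<noteq> 0"
    using p by (metis leading_coeff_neq_0)
  ultimately show ?thesis
    by blast
qed

end

section \<open>The free algebra\<close>

lemma poly_mapping_single_induct [case_names single add]:
  fixes p :: "'k \<Rightarrow>\<^sub>0 'r::comm_monoid_add"
  assumes "\<And>u c. P (Poly_Mapping.single u c)" "\<And>p q. P p \<Longrightarrow> P q \<Longrightarrow> P (p + q)"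
  shows "P p"
proof -
  have "P (\<Sum>w\<in>S. Poly_Mapping.single w (Poly_Mapping.lookup p w))" if "finite S" for S
    using that assms(1)[of undefined 0] by induction (simp_all add: assms)
  moreover have "p = (\<Sum>w\<in>Poly_Mapping.keys p. Poly_Mapping.single w (Poly_Mapping.lookup p w))"
    by (rule poly_mapping_eqI)
      (auto simp: lookup_sum lookup_single when_def in_keys_iff sum.delta' if_distrib)
  ultimately show ?thesis
    by (metis finite_keys)
qed

text \<open>
  The product of the free algebra as a convolution over the ways to cut a word in two. All
  coefficient computations below rest on this formula.
\<close>

lemma lookup_mult_words:
  fixes p q :: "'a::field ncpoly"
  shows "Poly_Mapping.lookup (p * q) w = (\<Sum>i\<le>length w. Poly_Mapping.lookup p (take i w) * Poly_Mapping.lookup q (drop i w))"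
proof (induction p rule: poly_mapping_single_induct)
  case (single u c)
  show ?case
  proof (induction q rule: poly_mapping_single_induct)
    case (single v d)
    show ?case
    proof (cases "w = u @ v")
      case True
      have "u \<noteq> take i w" if "i \<le> length w" "i \<noteq> length u" for i
        using that by (metis length_take min.absorb2)
      then have "(\<Sum>i\<le>length w. Poly_Mapping.lookup (Poly_Mapping.single u c) (take i w) * Poly_Mapping.lookup (Poly_Mapping.single v d) (drop i w))
          = (\<Sum>i\<in>{length u}. Poly_Mapping.lookup (Poly_Mapping.single u c) (take i w) * Poly_Mapping.lookup (Poly_Mapping.single v d) (drop i w))"
        using True by (intro sum.mono_neutral_right) (auto simp: lookup_single when_def)
      then show ?thesis
        using True by (simp add: mult_single plus_list_def)
    next
      case False
      then have "u \<noteq> take i w \<or> v \<noteq> drop i w" for i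
        by auto
      then have "(\<Sum>i\<le>length w. Poly_Mapping.lookup (Poly_Mapping.single u c) (take i w) * Poly_Mapping.lookup (Poly_Mapping.single v d) (drop i w)) = 0"
        by (intro sum.neutral) (auto simp: lookup_single when_def)
      then show ?thesis
        using False by (simp add: mult_single plus_list_def lookup_single)
    qed
  qed (simp_all add: distrib_left lookup_add sum.distrib)
qed (simp_all add: distrib_right lookup_add sum.distrib)

lemma lookup_mult_Nil: "Poly_Mapping.lookup (p * q :: 'a::field ncpoly) [] = Poly_Mapping.lookup p [] * Poly_Mapping.lookup q []"
  by (simp add: lookup_mult_words)

lemma lookup_one_words: "Poly_Mapping.lookup (1 :: 'a::field ncpoly) w = (if w = [] then 1 else 0)"
  by (simp add: lookup_one zero_list_def when_def)

lemma nc_scale_mult_left: "nc_scale c p * q = nc_scale c (p * q)"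
  by (simp add: nc_scale_eq_mult mult.assoc)

lemma nc_scale_mult_right: "p * nc_scale c q = nc_scale c (p * q)"
  by (rule poly_mapping_eqI) (simp add: lookup_mult_words lookup_nc_scale sum_distrib_left mult.left_commute)

lemma lookup_of_int_mult: "Poly_Mapping.lookup (of_int c * p :: 'a::field ncpoly) w = of_int c * Poly_Mapping.lookup p w"
  by (induction c rule: int_induct[where k = 0]) (simp_all add: distrib_right left_diff_distrib lookup_add lookup_minus)

lemma nc_degree_ge: "w \<in> Poly_Mapping.keys p \<Longrightarrow> length w \<le> nc_degree p"
  by (auto simp: nc_degree_def)

lemma nc_degree_attained:
  assumes "p \<noteq> 0"
  obtains w where "Poly_Mapping.lookup p w \<noteq> 0" "length w = nc_degree p"
proof -
  have "nc_degree p \<in> length ` Poly_Mapping.keys p"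
    using assms by (auto simp: nc_degree_def intro!: Max_in)
  then show ?thesis
    using that by (auto simp: in_keys_iff)
qed

text \<open>
  A word of length \<open>deg p + deg q\<close> has only one cut into a prefix and a suffix that are
  short enough to occur in \<open>p\<close> and \<open>q\<close>. So top coefficients multiply and nothing cancels.
\<close>

lemma nc_mult_nonzero:
  fixes p q :: "'a::field ncpoly"
  assumes "p \<noteq> 0" "q \<noteq> 0"
  shows "p * q \<noteq> 0" and "nc_degree (p * q) = nc_degree p + nc_degree q"
proof -
  obtain u where u: "Poly_Mapping.lookup p u \<noteq> 0" "length u = nc_degree p"
    using assms(1) by (rule nc_degree_attained)
  obtain v where v: "Poly_Mapping.lookup q v \<noteq> 0" "length v = nc_degree q"
    using assms(2) by (rule nc_degree_attained)
  have long: "Poly_Mapping.lookup r w = 0" if "length w > nc_degree r" for r :: "'a ncpoly" and w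
    using that nc_degree_ge[of w r] by (auto simp: in_keys_iff)
  have "Poly_Mapping.lookup (p * q) (u @ v)
      = (\<Sum>i\<in>{length u}. Poly_Mapping.lookup p (take i (u @ v)) * Poly_Mapping.lookup q (drop i (u @ v)))"
    unfolding lookup_mult_words
  proof (rule sum.mono_neutral_right)
    show "\<forall>i\<in>{..length (u @ v)} - {length u}. Poly_Mapping.lookup p (take i (u @ v)) * Poly_Mapping.lookup q (drop i (u @ v)) = 0"
    proof
      fix i assume i: "i \<in> {..length (u @ v)} - {length u}"
      then have "length (take i (u @ v)) > nc_degree p \<or> length (drop i (u @ v)) > nc_degree q"
        using u(2) v(2) by (cases "i < length u") auto
      then show "Poly_Mapping.lookup p (take i (u @ v)) * Poly_Mapping.lookup q (drop i (u @ v)) = 0"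
        using long by fastforce
    qed
  qed auto
  then have nz: "Poly_Mapping.lookup (p * q) (u @ v) \<noteq> 0"
    using u v by simp
  then show pq: "p * q \<noteq> 0"
    by auto
  obtain w where w: "Poly_Mapping.lookup (p * q) w \<noteq> 0" "length w = nc_degree (p * q)"
    using pq by (rule nc_degree_attained)
  then obtain i where i: "i \<le> length w" "Poly_Mapping.lookup p (take i w) \<noteq> 0" "Poly_Mapping.lookup q (drop i w) \<noteq> 0"
    unfolding lookup_mult_words by (metis (no_types, lifting) atMost_iff mult_eq_0_iff sum.neutral)
  have "length w \<le> nc_degree p + nc_degree q"
    using i nc_degree_ge[of "take i w" p] nc_degree_ge[of "drop i w" q] by (simp add: in_keys_iff)
  moreover have "nc_degree p + nc_degree q \<le> nc_degree (p * q)"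
    using nc_degree_ge[of "u @ v" "p * q"] nz u v by (simp add: in_keys_iff)
  ultimately show "nc_degree (p * q) = nc_degree p + nc_degree q"
    using w by simp
qed

lemma nc_power_nonzero: "p \<noteq> 0 \<Longrightarrow> (p :: 'a::field ncpoly) ^ k \<noteq> 0"
  by (induction k) (simp_all add: nc_mult_nonzero)

abbreviation nc_var :: "nat \<Rightarrow> 'a::field ncpoly" where
  "nc_var i \<equiv> Poly_Mapping.single [i] 1"

text \<open>
  Tracking the occurring variables and the degree together needs only one set of closure
  properties. The zero polynomial satisfies every bound.
\<close>

definition nc_bounded :: "nat \<Rightarrow> nat \<Rightarrow> 'a::field ncpoly set" where
  "nc_bounded n D = {p. \<forall>w. Poly_Mapping.lookup p w \<noteq> 0 \<longrightarrow> set w \<subseteq> {1..n} \<and> length w \<le> D}"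

lemma nc_bounded_mono: "p \<in> nc_bounded n D \<Longrightarrow> n \<le> n' \<Longrightarrow> D \<le> D' \<Longrightarrow> p \<in> nc_bounded n' D'"
  unfolding nc_bounded_def by fastforce

lemma nc_bounded_mult:
  assumes "p \<in> nc_bounded n D" "q \<in> nc_bounded n E"
  shows "p * q \<in> nc_bounded n (D + E)"
proof -
  have "set w \<subseteq> {1..n} \<and> length w \<le> D + E" if w: "Poly_Mapping.lookup (p * q) w \<noteq> 0" for w
  proof -
    obtain i where i: "i \<le> length w" "Poly_Mapping.lookup p (take i w) \<noteq> 0" "Poly_Mapping.lookup q (drop i w) \<noteq> 0"
      using w unfolding lookup_mult_words by (metis (no_types, lifting) atMost_iff mult_eq_0_iff sum.neutral)
    then have "set (take i w) \<subseteq> {1..n}" "length (take i w) \<le> D"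
        "set (drop i w) \<subseteq> {1..n}" "length (drop i w) \<le> E"
      using assms unfolding nc_bounded_def by blast+
    moreover have "set w = set (take i w) \<union> set (drop i w)"
      by (metis append_take_drop_id set_append)
    ultimately show ?thesis
      using i(1) by auto
  qed
  then show ?thesis
    by (auto simp: nc_bounded_def)
qed

lemma nc_bounded_one: "1 \<in> nc_bounded n D"
  by (simp add: nc_bounded_def lookup_one_words)

lemma nc_bounded_var: "i \<in> {1..n} \<Longrightarrow> 1 \<le> D \<Longrightarrow> nc_var i \<in> nc_bounded n D"
  by (simp add: nc_bounded_def lookup_single when_def)

lemma nc_bounded_prod_list:
  assumes "\<And>i. i \<in> set L \<Longrightarrow> g i \<in> nc_bounded n (e i)"
  shows "prod_list (map g L) \<in> nc_bounded n (sum_list (map e L))"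
  using assms by (induction L) (auto simp: nc_bounded_one intro: nc_bounded_mult)

lemma nc_bounded_sum_scaled:
  assumes "\<And>s. s \<in> S \<Longrightarrow> g s \<in> nc_bounded n D"
  shows "(\<Sum>s\<in>S. of_int (c s) * g s) \<in> nc_bounded n D"
proof -
  have "\<exists>s\<in>S. Poly_Mapping.lookup (g s) w \<noteq> 0" if "Poly_Mapping.lookup (\<Sum>s\<in>S. of_int (c s) * g s) w \<noteq> 0" for w
  proof (rule ccontr)
    assume "\<not> (\<exists>s\<in>S. Poly_Mapping.lookup (g s) w \<noteq> 0)"
    then show False
      using that by (simp add: lookup_sum lookup_of_int_mult)
  qed
  then show ?thesis
    using assms unfolding nc_bounded_def by fast
qed

lemma nc_bounded_degree: "p \<in> nc_polys n \<Longrightarrow> p \<in> nc_bounded n (nc_degree p)"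
  by (auto simp: nc_bounded_def nc_polys_def in_keys_iff intro!: nc_degree_ge)

lemma nc_bounded_imp_nc_polys: "p \<in> nc_bounded n D \<Longrightarrow> p \<in> nc_polys n"
  by (auto simp: nc_bounded_def nc_polys_def in_keys_iff)

lemma nc_bounded_imp_degree_le: "p \<in> nc_bounded n D \<Longrightarrow> nc_degree p \<le> D"
  by (cases "p = 0") (auto simp: nc_bounded_def nc_degree_def in_keys_iff)

lemma nc_bounded_power: "p \<in> nc_bounded n D \<Longrightarrow> p ^ k \<in> nc_bounded n (k * D)"
  by (induction k) (auto simp: nc_bounded_one intro: nc_bounded_mult)

text \<open>
  Cancelling the lowest power that occurs in a relation leaves a relation with a nonzero
  constant term, while positive powers of \<open>p\<close> have none. For \<open>d = 0\<close> the family is the single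
  element \<open>p\<close>, and constants are allowed.
\<close>

lemma nc_powers_independent:
  fixes p :: "'a::field ncpoly"
  assumes "p \<noteq> 0" "d = 0 \<or> Poly_Mapping.lookup p [] = 0"
  shows "\<not> lin_dep_family nc_scale {0..<Suc d} (\<lambda>i. p ^ Suc i)"
proof
  assume "lin_dep_family nc_scale {0..<Suc d} (\<lambda>i. p ^ Suc i)"
  then obtain \<alpha> j where j: "j \<in> {0..<Suc d}"
    and \<alpha>: "\<alpha> j \<noteq> 0" "(\<Sum>i\<in>{0..<Suc d}. nc_scale (\<alpha> i) (p ^ Suc i)) = 0"
    by (rule nc.lin_dep_familyE)
  define k where "k = (LEAST k. \<alpha> k \<noteq> 0)"
  have k: "\<alpha> k \<noteq> 0" "k \<le> d"
    using j \<alpha>(1) LeastI[of "\<lambda>k. \<alpha> k \<noteq> 0" j] Least_le[of "\<lambda>k. \<alpha> k \<noteq> 0" j] by (auto simp: k_def)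
  have below: "\<alpha> i = 0" if "i < k" for i
    using that not_less_Least[of i "\<lambda>k. \<alpha> k \<noteq> 0"] by (auto simp: k_def)
  define q where "q = (\<Sum>i\<in>{k..d}. nc_scale (\<alpha> i) (p ^ (i - k)))"
  have "p ^ Suc k * q = (\<Sum>i\<in>{k..d}. nc_scale (\<alpha> i) (p ^ Suc i))"
    unfolding q_def sum_distrib_left
  proof (intro sum.cong refl)
    fix i assume "i \<in> {k..d}"
    then have "Suc k + (i - k) = Suc i" by simp
    then show "p ^ Suc k * nc_scale (\<alpha> i) (p ^ (i - k)) = nc_scale (\<alpha> i) (p ^ Suc i)"
      by (simp only: nc_scale_mult_right power_add[symmetric])
  qed
  also have "\<dots> = (\<Sum>i\<in>{0..<Suc d}. nc_scale (\<alpha> i) (p ^ Suc i))"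
    by (intro sum.mono_neutral_left) (auto simp: below)
  finally have "p ^ Suc k * q = 0"
    using \<alpha>(2) by (rule trans)
  then have "q = 0"
    using nc_mult_nonzero(1)[of "p ^ Suc k" q] nc_power_nonzero[OF assms(1), of "Suc k"] by blast
  moreover have "Poly_Mapping.lookup q [] = (\<Sum>i\<in>{k}. \<alpha> i * Poly_Mapping.lookup (p ^ (i - k)) [])"
    unfolding q_def lookup_sum lookup_nc_scale
  proof (rule sum.mono_neutral_right)
    show "\<forall>i\<in>{k..d} - {k}. \<alpha> i * Poly_Mapping.lookup (p ^ (i - k)) [] = 0"
    proof
      fix i assume i: "i \<in> {k..d} - {k}"
      then have "Poly_Mapping.lookup p [] = 0"
        using assms(2) by auto
      moreover obtain l where "i - k = Suc l"
        using i by (cases "i - k") auto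
      ultimately show "\<alpha> i * Poly_Mapping.lookup (p ^ (i - k)) [] = 0"
        by (simp add: lookup_mult_Nil)
    qed
  qed (use k in auto)
  ultimately show False
    using k by (simp add: lookup_one_words)
qed

section \<open>Capelli polynomials\<close>

text \<open>
  Arguments and separators are indexed by the interval from \<open>k\<close> to \<open>m - 1\<close>, so that the
  expansion along the first position stays within the definition. The last factor
  \<open>y (m - 1)\<close> is always set to \<open>1\<close> in applications.
\<close>

definition capelli :: "nat \<Rightarrow> nat \<Rightarrow> (nat \<Rightarrow> 'r::ring_1) \<Rightarrow> (nat \<Rightarrow> 'r) \<Rightarrow> 'r" where
  "capelli k m x y =
     (\<Sum>\<sigma> | \<sigma> permutes {k..<m}. of_int (sign \<sigma>) * prod_list (map (\<lambda>i. x (\<sigma> i) * y i) [k..<m]))"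

lemma capelli_term_slot:
  fixes x y :: "nat \<Rightarrow> 'r::ring_1"
  assumes "\<sigma> permutes {k..<m}" "j \<in> {k..<m}"
  shows "\<exists>l r. \<forall>v. of_int (sign \<sigma>) * prod_list (map (\<lambda>i. (x(j := v)) (\<sigma> i) * y i) [k..<m]) = l * v * r"
proof -
  define p where "p = inv \<sigma> j"
  have p: "p \<in> {k..<m}" "\<sigma> p = j"
    using assms permutes_in_image[OF permutes_inv[OF assms(1)], of j]
    by (auto simp: p_def permutes_inverses)
  have other: "\<sigma> i \<noteq> j" if "i \<noteq> p" for i
    using that p(2) permutes_inj[OF assms(1)] by (auto simp: inj_def)
  have split: "[k..<m] = [k..<p] @ p # [Suc p..<m]"
    using p(1) upt_add_eq_append[of k p "m - p"] by (simp add: upt_conv_Cons)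
  have outer: "map (\<lambda>i. (x(j := v)) (\<sigma> i) * y i) [k..<p] = map (\<lambda>i. x (\<sigma> i) * y i) [k..<p]"
      "map (\<lambda>i. (x(j := v)) (\<sigma> i) * y i) [Suc p..<m] = map (\<lambda>i. x (\<sigma> i) * y i) [Suc p..<m]" for v
    by (auto simp: other)
  have "of_int (sign \<sigma>) * prod_list (map (\<lambda>i. (x(j := v)) (\<sigma> i) * y i) [k..<m])
     = (of_int (sign \<sigma>) * prod_list (map (\<lambda>i. x (\<sigma> i) * y i) [k..<p])) * v
       * (y p * prod_list (map (\<lambda>i. x (\<sigma> i) * y i) [Suc p..<m]))" for v
    by (simp only: split map_append list.map outer prod_list.append prod_list.Cons p(2) fun_upd_same mult.assoc)
  then show ?thesis
    by blast
qed

text \<open>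
  Multilinearity in a form that also isolates the factor in slot \<open>j\<close> of each summand. The
  sandwich \<open>l * v * r\<close> is what linear combinations and rank estimates need.
\<close>

lemma capelli_slot:
  fixes x y :: "nat \<Rightarrow> 'r::ring_1"
  assumes "j \<in> {k..<m}"
  obtains l r where "\<And>v. capelli k m (x(j := v)) y = (\<Sum>\<sigma> | \<sigma> permutes {k..<m}. l \<sigma> * v * r \<sigma>)"
proof -
  have "\<forall>\<sigma>\<in>{\<sigma>. \<sigma> permutes {k..<m}}. \<exists>lr. \<forall>v. of_int (sign \<sigma>) * prod_list (map (\<lambda>i. (x(j := v)) (\<sigma> i) * y i) [k..<m])
      = fst lr * v * snd lr"
    using capelli_term_slot[OF _ assms, of _ x y] by fastforce
  from bchoice[OF this] obtain lr where
    "\<forall>\<sigma>\<in>{\<sigma>. \<sigma> permutes {k..<m}}. \<forall>v. of_int (sign \<sigma>) * prod_list (map (\<lambda>i. (x(j := v)) (\<sigma> i) * y i) [k..<m])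
      = fst (lr \<sigma>) * v * snd (lr \<sigma>)" by (rule exE)
  then have "capelli k m (x(j := v)) y = (\<Sum>\<sigma> | \<sigma> permutes {k..<m}. fst (lr \<sigma>) * v * snd (lr \<sigma>))" for v
    unfolding capelli_def by (intro sum.cong) (auto simp del: fun_upd_apply)
  then show ?thesis
    by (rule that)
qed

text \<open>
  Composition with the transposition of \<open>i\<close> and \<open>j\<close> pairs even with odd permutations whose
  products agree. The pairing works in characteristic two as well, unlike the argument from
  antisymmetry.
\<close>

lemma capelli_eq_zero_if_repeated:
  fixes x y :: "nat \<Rightarrow> 'r::ring_1"
  assumes "i \<in> {k..<m}" "j \<in> {k..<m}" "i \<noteq> j" "x i = x j"
  shows "capelli k m x y = 0"
proof -
  let ?P = "{\<sigma>. \<sigma> permutes {k..<m}}"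
  let ?t = "transpose i j"
  define g where "g \<sigma> = of_int (sign \<sigma>) * prod_list (map (\<lambda>i. x (\<sigma> i) * y i) [k..<m])" for \<sigma>
  have perm: "permutation \<sigma>" if "\<sigma> \<in> ?P" for \<sigma>
    using that permutes_imp_permutation[of "{k..<m}"] by auto
  have tP: "?t \<circ> \<sigma> \<in> ?P" if "\<sigma> \<in> ?P" for \<sigma>
    using that assms by (auto intro!: permutes_compose permutes_swap_id)
  have "x (?t l) = x l" for l
    using assms(4) by (simp add: transpose_def)
  then have gt: "g (?t \<circ> \<sigma>) = - g \<sigma>" if "\<sigma> \<in> ?P" for \<sigma>
    using assms(3) perm[OF that] by (simp add: g_def sign_compose permutation_swap_id sign_swap_id)
  have even_t: "evenperm (?t \<circ> \<sigma>) \<longleftrightarrow> \<not> evenperm \<sigma>" if "\<sigma> \<in> ?P" for \<sigma>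
    using assms(3) perm[OF that] by (simp add: evenperm_comp permutation_swap_id evenperm_swap)
  \<comment> \<open>Splitting by parity, and not just reindexing the sum, is what covers characteristic two.\<close>
  have "sum g ?P = sum g {\<sigma> \<in> ?P. evenperm \<sigma>} + sum g {\<sigma> \<in> ?P. \<not> evenperm \<sigma>}"
    by (subst sum.union_disjoint[symmetric])
      (auto simp: finite_permutations intro!: sum.cong finite_subset[OF _ finite_permutations[of "{k..<m}"]])
  also have "sum g {\<sigma> \<in> ?P. \<not> evenperm \<sigma>} = (\<Sum>\<sigma> \<in> {\<sigma> \<in> ?P. evenperm \<sigma>}. - g \<sigma>)"
    by (rule sum.reindex_bij_witness[of _ "\<lambda>\<sigma>. ?t \<circ> \<sigma>" "\<lambda>\<sigma>. ?t \<circ> \<sigma>"])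
      (use tP gt even_t in \<open>auto simp: o_assoc[symmetric] simp del: o_apply simp: comp_assoc[symmetric]\<close>)
  finally show ?thesis
    by (simp add: capelli_def g_def sum_negf)
qed

text \<open>
  Expand the replaced slot: every summand with \<open>i \<noteq> j\<close> has a repeated argument.
\<close>

lemma capelli_combination:
  fixes x y :: "nat \<Rightarrow> 'a::field ncpoly"
  assumes "j \<in> {k..<m}"
  shows "capelli k m (x(j := \<Sum>i\<in>{k..<m}. nc_scale (\<alpha> i) (x i))) y = nc_scale (\<alpha> j) (capelli k m x y)"
proof -
  obtain l r where lr: "\<And>v. capelli k m (x(j := v)) y = (\<Sum>\<sigma> | \<sigma> permutes {k..<m}. l \<sigma> * v * r \<sigma>)"
    using capelli_slot[OF assms, of x y] by blast
  have "capelli k m (x(j := \<Sum>i\<in>{k..<m}. nc_scale (\<alpha> i) (x i))) y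
      = (\<Sum>\<sigma> | \<sigma> permutes {k..<m}. \<Sum>i\<in>{k..<m}. nc_scale (\<alpha> i) (l \<sigma> * x i * r \<sigma>))"
    unfolding lr by (simp add: sum_distrib_left sum_distrib_right nc_scale_mult_left nc_scale_mult_right)
  also have "\<dots> = (\<Sum>i\<in>{k..<m}. nc_scale (\<alpha> i) (capelli k m (x(j := x i)) y))"
    unfolding lr nc.scale_sum_right by (rule sum.swap)
  also have "\<dots> = (\<Sum>i\<in>{j}. nc_scale (\<alpha> i) (capelli k m (x(j := x i)) y))"
  proof (rule sum.mono_neutral_right)
    show "\<forall>i\<in>{k..<m} - {j}. nc_scale (\<alpha> i) (capelli k m (x(j := x i)) y) = 0"
      using assms capelli_eq_zero_if_repeated[where j = j and x = "x(j := x i)" for i] by fastforce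
  qed (use assms in auto)
  finally show ?thesis
    by simp
qed

text \<open>
  The Laplace expansion along the first position, sorted by the index \<open>b\<close> that a permutation
  puts there. Writing the permutation as a transposition after a permutation of the
  remaining positions avoids deleting indices.
\<close>

lemma capelli_expand:
  fixes x y :: "nat \<Rightarrow> 'r::ring_1"
  assumes "k < m"
  shows "capelli k m x y = (\<Sum>b\<in>{k..<m}. of_int (sign (transpose k b)) *
    (x b * y k * capelli (Suc k) m (x \<circ> transpose k b) y))"
proof -
  have ins: "{k..<m} = insert k {Suc k..<m}"
    using assms by auto
  have "capelli k m x y = (\<Sum>b\<in>{k..<m}. \<Sum>\<sigma> | \<sigma> permutes {Suc k..<m}.
     of_int (sign (transpose k b \<circ> \<sigma>)) * prod_list (map (\<lambda>i. x ((transpose k b \<circ> \<sigma>) i) * y i) [k..<m]))"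
    unfolding capelli_def ins by (rule sum_over_permutations_insert) auto
  also have "\<dots> = (\<Sum>b\<in>{k..<m}. of_int (sign (transpose k b)) *
    (x b * y k * capelli (Suc k) m (x \<circ> transpose k b) y))"
    unfolding capelli_def sum_distrib_left
  proof (intro sum.cong refl)
    fix b \<sigma> assume "\<sigma> \<in> {\<sigma>. \<sigma> permutes {Suc k..<m}}"
    then have s: "\<sigma> permutes {Suc k..<m}" by simp
    have "permutation \<sigma>"
      using s permutes_imp_permutation[of "{Suc k..<m}"] by auto
    moreover have "\<sigma> k = k"
      using s by (simp add: permutes_not_in)
    moreover have comm: "x b * y k * (of_int (sign \<sigma>) * z) = of_int (sign \<sigma>) * (x b * y k * z)" for z
      by (simp add: sign_def)
    ultimately show "of_int (sign (transpose k b \<circ> \<sigma>)) * prod_list (map (\<lambda>i. x ((transpose k b \<circ> \<sigma>) i) * y i) [k..<m])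
      = of_int (sign (transpose k b)) * (x b * y k * (of_int (sign \<sigma>) *
        prod_list (map (\<lambda>i. (x \<circ> transpose k b) (\<sigma> i) * y i) [Suc k..<m])))"
      using assms unfolding comm
      by (simp add: upt_conv_Cons sign_compose permutation_swap_id mult.assoc)
  qed
  finally show ?thesis .
qed

lemma lookup_var_mult:
  "Poly_Mapping.lookup (nc_var z * r :: 'a::field ncpoly) w = (if w \<noteq> [] \<and> hd w = z then Poly_Mapping.lookup r (tl w) else 0)"
proof (cases w)
  case Nil
  then show ?thesis by (simp add: lookup_mult_Nil lookup_single)
next
  case (Cons a w')
  have "Poly_Mapping.lookup (nc_var z * r) w = (\<Sum>i\<in>{1}. Poly_Mapping.lookup (nc_var z :: 'a ncpoly) (take i w) * Poly_Mapping.lookup r (drop i w))"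
    unfolding lookup_mult_words
  proof (rule sum.mono_neutral_right)
    show "\<forall>i\<in>{..length w} - {1}. Poly_Mapping.lookup (nc_var z :: 'a ncpoly) (take i w) * Poly_Mapping.lookup r (drop i w) = 0"
    proof
      fix i assume "i \<in> {..length w} - {1}"
      then have "length (take i w) \<noteq> length [z]" by auto
      then have "[z] \<noteq> take i w" by metis
      then show "Poly_Mapping.lookup (nc_var z :: 'a ncpoly) (take i w) * Poly_Mapping.lookup r (drop i w) = 0"
        by (simp add: lookup_single)
    qed
  qed (use Cons in auto)
  then show ?thesis
    using Cons by (auto simp: lookup_single when_def)
qed

text \<open>
  A letter that is foreign to \<open>p\<close> marks the only place where a word of the product can be
  cut.
\<close>

lemma lookup_mult_separated:
  fixes p r :: "'a::field ncpoly"
  assumes "\<And>w. Poly_Mapping.lookup p w \<noteq> 0 \<Longrightarrow> z \<notin> set w" "z \<notin> set u"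
  shows "Poly_Mapping.lookup (p * nc_var z * r) (u @ z # v) = Poly_Mapping.lookup p u * Poly_Mapping.lookup r v"
proof -
  let ?w = "u @ z # v"
  have "Poly_Mapping.lookup (p * nc_var z * r) ?w
      = (\<Sum>i\<in>{length u}. Poly_Mapping.lookup p (take i ?w) * Poly_Mapping.lookup (nc_var z * r) (drop i ?w))"
    unfolding mult.assoc lookup_mult_words[of p]
  proof (rule sum.mono_neutral_right)
    show "\<forall>i\<in>{..length ?w} - {length u}. Poly_Mapping.lookup p (take i ?w) * Poly_Mapping.lookup (nc_var z * r) (drop i ?w) = 0"
    proof
      fix i assume i: "i \<in> {..length ?w} - {length u}"
      show "Poly_Mapping.lookup p (take i ?w) * Poly_Mapping.lookup (nc_var z * r) (drop i ?w) = 0"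
      proof (cases "i < length u")
        case True
        then have "drop i ?w = u ! i # drop (Suc i) ?w"
          by (simp add: Cons_nth_drop_Suc)
        moreover have "u ! i \<noteq> z"
          using True assms(2) by auto
        ultimately show ?thesis
          by (simp add: lookup_var_mult)
      next
        case False
        then have "z \<in> set (take i ?w)"
          using i by (cases "i - length u") auto
        then show ?thesis
          using assms(1) by fastforce
      qed
    qed
  qed auto
  then show ?thesis
    by (simp add: lookup_var_mult)
qed

text \<open>
  By induction the Capelli polynomial of all \<open>x\<^sub>i\<close> but the first has a word \<open>u\<close> with nonzero
  coefficient. If the whole polynomial were zero, then the coefficients of the words
  \<open>w @ z\<^sub>k # u\<close>, for all \<open>w\<close>, would be a linear relation between the \<open>x\<^sub>i\<close> in which \<open>x\<^sub>k\<close>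
  occurs.
\<close>

lemma capelli_nonzero:
  fixes x y :: "nat \<Rightarrow> 'a::field ncpoly"
  assumes "k < m" and "\<And>i. i \<in> {k..<m} \<Longrightarrow> x i \<in> nc_polys n"
    and "\<not> lin_dep_family nc_scale {k..<m} x"
    and "\<And>i. i \<in> {k..<m - 1} \<Longrightarrow> y i = nc_var (z i) \<and> z i > n" and "y (m - 1) = 1"
  shows "capelli k m x y \<noteq> 0"
  using assms
proof (induction "m - k" arbitrary: k x)
  case 0
  then show ?case by simp
next
  case (Suc d)
  show ?case
  proof (cases "Suc k = m")
    case True
    then have iv: "{k..<m} = {k}" "[k..<m] = [k]" "m - 1 = k"
      by (auto simp: upt_conv_Cons)
    have "x k \<noteq> 0"
    proof
      assume "x k = 0"
      then have "lin_dep_family nc_scale {k..<m} x"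
        unfolding lin_dep_family_def iv by (intro exI[of _ "\<lambda>_. 1"]) simp
      then show False
        using Suc.prems by simp
    qed
    then show ?thesis
      using Suc.prems(5) iv(3) by (simp add: capelli_def iv)
  next
    case False
    then have km: "Suc k < m"
      using Suc.prems(1) by simp
    have yk: "y k = nc_var (z k)" "z k > n"
      using Suc.prems(4)[of k] km by auto
    have "capelli (Suc k) m x y \<noteq> 0"
    proof (rule Suc.hyps(1))
      show "\<not> lin_dep_family nc_scale {Suc k..<m} x"
        using Suc.prems(3) nc.lin_dep_family_mono[of "{Suc k..<m}" x "{k..<m}"] by auto
    qed (use Suc.prems Suc.hyps(2) km in auto)
    then obtain u where u: "Poly_Mapping.lookup (capelli (Suc k) m x y) u \<noteq> 0"
      by (metis lookup_zero poly_mapping_eqI)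
    \<comment> \<open>The separator does not occur in any \<open>x b\<close>, so \<open>lookup_mult_separated\<close> applies.\<close>
    have fresh: "z k \<notin> set w" if "b \<in> {k..<m}" "Poly_Mapping.lookup (x b) w \<noteq> 0" for b w
      using Suc.prems(2)[OF that(1)] that(2) yk(2) by (fastforce simp: nc_polys_def in_keys_iff)
    define \<beta> where "\<beta> b = of_int (sign (transpose k b)) * Poly_Mapping.lookup (capelli (Suc k) m (x \<circ> transpose k b) y) u" for b
    show ?thesis
    proof
      assume zero: "capelli k m x y = 0"
      have "(\<Sum>b\<in>{k..<m}. nc_scale (\<beta> b) (x b)) = 0"
      proof (rule poly_mapping_eqI)
        fix w
        show "Poly_Mapping.lookup (\<Sum>b\<in>{k..<m}. nc_scale (\<beta> b) (x b)) w = Poly_Mapping.lookup 0 w"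
        proof (cases "z k \<in> set w")
          case True
          then show ?thesis
            using fresh by (auto simp: lookup_sum lookup_nc_scale intro!: sum.neutral)
        next
          case False
          have "Poly_Mapping.lookup (capelli k m x y) (w @ z k # u) = (\<Sum>b\<in>{k..<m}. \<beta> b * Poly_Mapping.lookup (x b) w)"
            unfolding capelli_expand[OF Suc.prems(1)] lookup_sum lookup_of_int_mult yk(1)
            using fresh False
            by (intro sum.cong) (simp_all add: lookup_mult_separated \<beta>_def)
          then show ?thesis
            using zero by (simp add: lookup_sum lookup_nc_scale)
        qed
      qed
      moreover have "\<beta> k \<noteq> 0"
        using u by (simp add: \<beta>_def)
      ultimately have "lin_dep_family nc_scale {k..<m} x"
        using Suc.prems(1) by (intro nc.lin_dep_familyI[of k]) auto
      then show False
        using Suc.prems(3) by simp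
    qed
  qed
qed

lemma capelli_constant_term:
  fixes x y :: "nat \<Rightarrow> 'a::field ncpoly"
  assumes "k < m" "Poly_Mapping.lookup (y k) [] = 0"
  shows "Poly_Mapping.lookup (capelli k m x y) [] = 0"
  unfolding capelli_expand[OF assms(1)] lookup_sum lookup_of_int_mult lookup_mult_Nil assms(2) by simp

lemma capelli_bounded:
  fixes x y :: "nat \<Rightarrow> 'a::field ncpoly"
  assumes "\<And>i. i \<in> {k..<m} \<Longrightarrow> x i \<in> nc_bounded n (D i)" "\<And>i. i \<in> {k..<m} \<Longrightarrow> y i \<in> nc_bounded n (E i)"
  shows "capelli k m x y \<in> nc_bounded n ((\<Sum>i\<in>{k..<m}. D i) + (\<Sum>i\<in>{k..<m}. E i))"
  unfolding capelli_def
proof (rule nc_bounded_sum_scaled)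
  fix \<sigma> assume "\<sigma> \<in> {\<sigma>. \<sigma> permutes {k..<m}}"
  then have \<sigma>: "\<sigma> permutes {k..<m}" by simp
  have "prod_list (map (\<lambda>i. x (\<sigma> i) * y i) [k..<m]) \<in> nc_bounded n (sum_list (map (\<lambda>i. D (\<sigma> i) + E i) [k..<m]))"
    using assms permutes_in_image[OF \<sigma>] by (intro nc_bounded_prod_list nc_bounded_mult) auto
  moreover have "(\<Sum>i\<in>{k..<m}. D (\<sigma> i)) = (\<Sum>i\<in>{k..<m}. D i)"
    using sum.permute[OF \<sigma>, of D] by (simp add: comp_def)
  ultimately show "prod_list (map (\<lambda>i. x (\<sigma> i) * y i) [k..<m])
      \<in> nc_bounded n ((\<Sum>i\<in>{k..<m}. D i) + (\<Sum>i\<in>{k..<m}. E i))"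
    by (simp add: interv_sum_list_conv_sum_set_nat sum.distrib)
qed

section \<open>Evaluating Capelli polynomials at operators\<close>

context vector_space
begin

lemma linear_word_eval:
  assumes "\<And>i. Vector_Spaces.linear scale scale (a i)"
  shows "Vector_Spaces.linear scale scale (word_eval a w)"
proof (induction w)
  case Nil
  show ?case using linear_id by (simp add: word_eval_def id_def)
next
  case (Cons i w)
  then show ?case
    using Vector_Spaces.linear_compose[OF Cons assms[of i]] by (simp add: word_eval_def o_def)
qed

lemma nc_eval_superset:
  assumes "finite S" "Poly_Mapping.keys p \<subseteq> S"
  shows "nc_eval scale p a v = (\<Sum>w\<in>S. Poly_Mapping.lookup p w *s word_eval a w v)"
  unfolding nc_eval_def using assms by (intro sum.mono_neutral_left) (auto simp: in_keys_iff)

lemma nc_eval_add: "nc_eval scale (p + q) a v = nc_eval scale p a v + nc_eval scale q a v"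
  using keys_add[of p q]
  by (simp add: nc_eval_superset[of "Poly_Mapping.keys p \<union> Poly_Mapping.keys q"] lookup_add
      scale_left_distrib sum.distrib)

lemma nc_eval_zero: "nc_eval scale 0 a v = 0"
  by (simp add: nc_eval_def)

lemma nc_eval_sum: "nc_eval scale (\<Sum>i\<in>I. p i) a v = (\<Sum>i\<in>I. nc_eval scale (p i) a v)"
  by (induction I rule: infinite_finite_induct) (simp_all add: nc_eval_zero nc_eval_add)

lemma nc_eval_scale: "nc_eval scale (nc_scale c p) a v = c *s nc_eval scale p a v"
  by (subst nc_eval_superset[of "Poly_Mapping.keys p"])
    (auto simp: in_keys_iff lookup_nc_scale nc_eval_def scale_sum_right)

lemma nc_eval_one: "nc_eval scale 1 a v = v"
proof -
  have "Poly_Mapping.keys (1 :: 'a ncpoly) \<subseteq> {[]}"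
    by (auto simp: in_keys_iff lookup_one_words zero_list_def)
  then show ?thesis
    by (subst nc_eval_superset[of "{[]}"]) (simp_all add: lookup_one_words word_eval_def del: keys_one)
qed

lemma linear_nc_eval:
  assumes "\<And>i. Vector_Spaces.linear scale scale (a i)"
  shows "Vector_Spaces.linear scale scale (nc_eval scale p a)"
proof -
  have "word_eval a w (u + v) = word_eval a w u + word_eval a w v"
      "word_eval a w (c *s u) = c *s word_eval a w u" for w u v c
  proof -
    interpret Vector_Spaces.linear scale scale "word_eval a w"
      using linear_word_eval[OF assms] .
    show "word_eval a w (u + v) = word_eval a w u + word_eval a w v"
      "word_eval a w (c *s u) = c *s word_eval a w u" by (simp_all add: add scale)
  qed
  then show ?thesis
    unfolding nc_eval_def
    by unfold_locales (simp_all add: scale_right_distrib sum.distrib scale_sum_right mult.commute)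
qed

lemma nc_eval_mult_linear:
  assumes "\<And>i. Vector_Spaces.linear scale scale (a i)"
  shows "nc_eval scale (p * q) a = nc_eval scale p a \<circ> nc_eval scale q a"
  using nc_eval_mult[OF vector_space_axioms assms] .

lemma nc_eval_power:
  assumes "\<And>i. Vector_Spaces.linear scale scale (a i)"
  shows "nc_eval scale (p ^ k) a = nc_eval scale p a ^^ k"
  by (induction k) (simp_all add: fun_eq_iff nc_eval_one nc_eval_mult_linear[OF assms])

lemma nc_eval_cong:
  assumes "p \<in> nc_polys n" "\<And>i. i \<in> {1..n} \<Longrightarrow> a i = b i"
  shows "nc_eval scale p a = nc_eval scale p b"
proof -
  have "word_eval a w = word_eval b w" if "set w \<subseteq> {1..n}" for w
    using that assms(2) by (induction w) (auto simp: word_eval_def)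
  then show ?thesis
    using assms(1) unfolding nc_eval_def nc_polys_def by (auto intro!: ext sum.cong)
qed

text \<open>
  Put the low-rank combination into slot \<open>j\<close>. The polynomial changes by the factor \<open>\<alpha> j \<noteq> 0\<close>
  only, and each summand, one for each permutation, gets a factor of rank at most \<open>r\<close>.
\<close>

lemma rank_le_capelli:
  assumes lin: "\<And>i. Vector_Spaces.linear scale scale (a i)"
    and j: "j \<in> {k..<m}" "\<alpha> j \<noteq> 0"
    and rank: "rank_le scale (\<lambda>v. \<Sum>i\<in>{k..<m}. \<alpha> i *s nc_eval scale (x i) a v) r"
  shows "rank_le scale (nc_eval scale (capelli k m x y) a) (fact (m - k) * r)"
proof -
  define q where "q = (\<Sum>i\<in>{k..<m}. nc_scale (\<alpha> i) (x i))"
  have q: "rank_le scale (nc_eval scale q a) r"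
  proof -
    have "nc_eval scale q a = (\<lambda>v. \<Sum>i\<in>{k..<m}. \<alpha> i *s nc_eval scale (x i) a v)"
      by (simp add: fun_eq_iff q_def nc_eval_sum nc_eval_scale)
    then show ?thesis
      using rank by simp
  qed
  obtain l s where ls: "\<And>v. capelli k m (x(j := v)) y = (\<Sum>\<sigma> | \<sigma> permutes {k..<m}. l \<sigma> * v * s \<sigma>)"
    using capelli_slot[OF j(1), of x y] by blast
  have "rank_le scale (\<lambda>v. \<Sum>\<sigma> | \<sigma> permutes {k..<m}. nc_eval scale (l \<sigma> * q * s \<sigma>) a v)
      (card {\<sigma>. \<sigma> permutes {k..<m}} * r)"
  proof (rule rank_le_sum)
    show "finite {\<sigma>. \<sigma> permutes {k..<m}}"
      by (rule finite_permutations) simp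
    fix \<sigma>
    show "rank_le scale (nc_eval scale (l \<sigma> * q * s \<sigma>) a) r"
      unfolding nc_eval_mult_linear[OF lin] by (rule rank_le_compose[OF linear_nc_eval[OF lin] q])
  qed
  moreover have "card {\<sigma>. \<sigma> permutes {k..<m}} = fact (m - k)"
    by (rule card_permutations) simp_all
  ultimately have "rank_le scale (nc_eval scale (capelli k m (x(j := q)) y) a) (fact (m - k) * r)"
    by (simp add: ls nc_eval_sum[abs_def])
  then have "rank_le scale (nc_eval scale (nc_scale (\<alpha> j) (capelli k m x y)) a) (fact (m - k) * r)"
    using capelli_combination[OF j(1), of x \<alpha> y] by (simp add: q_def)
  then have "rank_le scale (nc_eval scale (nc_scale (inverse (\<alpha> j)) 1) a
      \<circ> nc_eval scale (nc_scale (\<alpha> j) (capelli k m x y)) a \<circ> id) (fact (m - k) * r)"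
    by (rule rank_le_compose[OF linear_nc_eval[OF lin]])
  moreover have "nc_eval scale (nc_scale (inverse (\<alpha> j)) 1) a
      \<circ> nc_eval scale (nc_scale (\<alpha> j) (capelli k m x y)) a \<circ> id = nc_eval scale (capelli k m x y) a"
    using j(2) by (simp add: fun_eq_iff nc_eval_scale nc_eval_one)
  ultimately show ?thesis
    by simp
qed

lemma rank_le_zero_iff: "rank_le scale T 0 \<longleftrightarrow> (\<forall>v. T v = 0)"
  unfolding rank_le_def by (auto simp: image_subset_iff)

text \<open>
  This is the rank bound for Capelli polynomials in the extreme case \<open>r = 0\<close>.
\<close>

lemma capelli_of_powers_vanishes:
  assumes lin: "\<And>i. Vector_Spaces.linear scale scale (a i)"
    and "rank_le scale (nc_eval scale p a) d"
  shows "nc_eval scale (capelli 0 (Suc d) (\<lambda>i. p ^ Suc i) z) a v = 0"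
proof -
  obtain \<alpha> j where \<alpha>: "j \<le> d" "\<alpha> j \<noteq> 0"
      "\<forall>v. (\<Sum>i\<le>d. \<alpha> i *s (nc_eval scale p a ^^ Suc i) v) = 0"
    using powers_dependent_if_rank_le[OF linear_nc_eval[OF lin] assms(2)] by blast
  have "rank_le scale (\<lambda>v. \<Sum>i\<in>{0..<Suc d}. \<alpha> i *s nc_eval scale (p ^ Suc i) a v) 0"
    unfolding rank_le_zero_iff nc_eval_power[OF lin] atLeast0LessThan lessThan_Suc_atMost
    by (rule \<alpha>(3))
  then have "rank_le scale (nc_eval scale (capelli 0 (Suc d) (\<lambda>i. p ^ Suc i) z) a) (fact (Suc d - 0) * 0)"
    using \<alpha>(1,2) by (intro rank_le_capelli[OF lin, of j]) auto
  then show ?thesis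
    by (simp add: rank_le_zero_iff)
qed

end

section \<open>The polynomial identity\<close>

theorem theorem3p7:
  fixes scale :: "'a::field \<Rightarrow> 'v::ab_group_add \<Rightarrow> 'v"
    and A :: "('v \<Rightarrow> 'v) set"
    and f :: "nat \<Rightarrow> 'a ncpoly"
    and m n d \<gamma> :: nat
  assumes "vector_space scale"
    and "operator_algebra scale A"
    and "m \<ge> 1" and "n \<ge> 1"
    and "\<forall>j \<in> {1..m}. f j \<in> nc_polys n"
    and "locally_dir_lin_dep scale A n m f"
    and "d = (m - 1) * fact m"
    and "\<gamma> = (d + 1) * (d + 2) div 2 * (m - 1 + (\<Sum>j = 1..m. nc_degree (f j))) + d"
    and "\<not> satisfies_PI_of_degree scale A \<gamma>"
  shows "lin_dep_family nc_scale {1..m} f"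
proof (rule ccontr)
  assume indep: "\<not> lin_dep_family nc_scale {1..m} f"
  interpret vector_space scale by fact
  define D where "D = m - 1 + (\<Sum>j = 1..m. nc_degree (f j))"
  define N where "N = n + m + d"
  define x where "x i = f (Suc i)" for i
  define y :: "nat \<Rightarrow> 'a ncpoly" where "y i = (if i < m - 1 then nc_var (n + 1 + i) else 1)" for i
  define z :: "nat \<Rightarrow> 'a ncpoly" where "z i = (if i < d then nc_var (n + m + i) else 1)" for i
  define P where "P = capelli 0 m x y"
  define Q where "Q = capelli 0 (Suc d) (\<lambda>i. P ^ Suc i) z"
  \<comment> \<open>The factor pads the degree from \<open>nc_degree Q\<close> up to \<open>\<gamma>\<close>.\<close>
  define R where "R = Q * nc_var 1 ^ (\<gamma> - nc_degree Q)"

  have x_poly: "x i \<in> nc_polys n" if "i \<in> {0..<m}" for i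
    using assms(5) that by (auto simp: x_def)
  have x_indep: "\<not> lin_dep_family nc_scale {0..<m} x"
  proof
    assume "lin_dep_family nc_scale {0..<m} x"
    then obtain \<alpha> j where \<alpha>: "j \<in> {0..<m}" "\<alpha> j \<noteq> 0" "(\<Sum>i\<in>{0..<m}. nc_scale (\<alpha> i) (x i)) = 0"
      by (rule nc.lin_dep_familyE)
    have "(\<Sum>i = 1..m. nc_scale (\<alpha> (i - 1)) (f i)) = (\<Sum>i\<in>{0..<m}. nc_scale (\<alpha> i) (x i))"
      by (rule sum.reindex_bij_witness[of _ Suc "\<lambda>i. i - 1"]) (auto simp: x_def)
    then have "lin_dep_family nc_scale {1..m} f"
      using \<alpha> by (intro nc.lin_dep_familyI[of "Suc j" _ "\<lambda>i. \<alpha> (i - 1)"]) auto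
    then show False
      using indep by simp
  qed

  have P_nonzero: "P \<noteq> 0"
    unfolding P_def
    by (rule capelli_nonzero[where z = "\<lambda>i. n + 1 + i", OF _ x_poly x_indep])
      (use assms(3) in \<open>auto simp: y_def\<close>)
  have P_bounded: "P \<in> nc_bounded (n + m - 1) D"
  proof -
    have "P \<in> nc_bounded (n + m - 1) ((\<Sum>i\<in>{0..<m}. nc_degree (x i)) + (\<Sum>i\<in>{0..<m}. if i < m - 1 then 1 else 0))"
      unfolding P_def
    proof (rule capelli_bounded)
      fix i assume i: "i \<in> {0..<m}"
      show "x i \<in> nc_bounded (n + m - 1) (nc_degree (x i))"
        by (rule nc_bounded_mono[OF nc_bounded_degree[OF x_poly[OF i]]]) (use assms(3) in auto)
      show "y i \<in> nc_bounded (n + m - 1) (if i < m - 1 then 1 else 0)"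
        by (auto simp: y_def nc_bounded_one intro!: nc_bounded_var)
    qed
    also have "(\<Sum>i\<in>{0..<m}. nc_degree (x i)) = (\<Sum>j = 1..m. nc_degree (f j))"
      by (rule sum.reindex_bij_witness[of _ "\<lambda>i. i - 1" Suc]) (auto simp: x_def)
    also have "(\<Sum>i\<in>{0..<m}. if i < m - 1 then 1 else 0) = m - 1"
    proof -
      have "{0..<m} = insert (m - 1) {0..<m - 1}"
        using assms(3) by auto
      then show ?thesis
        by simp
    qed
    finally show ?thesis
      by (simp add: D_def add.commute)
  qed
  \<comment> \<open>For \<open>m > 1\<close> every word of \<open>P\<close> contains the separator \<open>y 0\<close>.\<close>
  have P_const: "d = 0 \<or> Poly_Mapping.lookup P [] = 0"
  proof (cases "m = 1")
    case True
    then show ?thesis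
      using assms(7) by simp
  next
    case False
    then show ?thesis
      unfolding P_def using assms(3)
      by (intro disjI2 capelli_constant_term) (auto simp: y_def lookup_single)
  qed

  have Q_nonzero: "Q \<noteq> 0"
    unfolding Q_def
  proof (rule capelli_nonzero[where z = "\<lambda>i. n + m + i"])
    show "P ^ Suc i \<in> nc_polys (n + m - 1)" for i
      using nc_bounded_power[OF P_bounded, of "Suc i"] by (rule nc_bounded_imp_nc_polys)
    show "\<not> lin_dep_family nc_scale {0..<Suc d} (\<lambda>i. P ^ Suc i)"
      using P_nonzero P_const by (rule nc_powers_independent)
  qed (use assms(4) in \<open>auto simp: z_def\<close>)
  have Q_bounded: "Q \<in> nc_bounded N \<gamma>"
  proof -
    have "Q \<in> nc_bounded N ((\<Sum>i\<in>{0..<Suc d}. Suc i * D) + (\<Sum>i\<in>{0..<Suc d}. if i < d then 1 else 0))"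
      unfolding Q_def
    proof (rule capelli_bounded)
      fix i assume i: "i \<in> {0..<Suc d}"
      show "P ^ Suc i \<in> nc_bounded N (Suc i * D)"
        using nc_bounded_power[OF P_bounded, of "Suc i"] by (rule nc_bounded_mono) (auto simp: N_def)
      show "z i \<in> nc_bounded N (if i < d then 1 else 0)"
        using assms(4) by (auto simp: z_def N_def nc_bounded_one intro!: nc_bounded_var)
    qed
    also have "(\<Sum>i\<in>{0..<Suc d}. Suc i * D) = (d + 1) * (d + 2) div 2 * D"
    proof -
      have "(\<Sum>i\<in>{0..<Suc d}. Suc i) = (d + 1) * (d + 2) div 2"
        by (induction d) auto
      then show ?thesis
        by (metis sum_distrib_right)
    qed
    also have "(\<Sum>i\<in>{0..<Suc d}. if i < d then 1 else 0) = d"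
      by simp
    finally show ?thesis
      by (simp add: assms(8) D_def)
  qed

  have var1: "nc_var 1 ^ k \<noteq> (0 :: 'a ncpoly) \<and> nc_degree (nc_var 1 ^ k :: 'a ncpoly) = k" for k
  proof (induction k)
    case 0
    show ?case
      by (simp add: nc_degree_def zero_list_def)
  next
    case (Suc k)
    have "Poly_Mapping.lookup (nc_var 1 :: 'a ncpoly) [1] \<noteq> 0"
      by simp
    then have "nc_var 1 \<noteq> (0 :: 'a ncpoly)"
      by (metis lookup_zero)
    moreover from this have "nc_degree (nc_var 1 :: 'a ncpoly) = 1"
      by (simp add: nc_degree_def)
    ultimately show ?case
      using Suc nc_mult_nonzero[of "nc_var 1 :: 'a ncpoly" "nc_var 1 ^ k"] by simp
  qed
  have "R \<noteq> 0" "nc_degree R = \<gamma>"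
    using nc_mult_nonzero[OF Q_nonzero, of "nc_var 1 ^ (\<gamma> - nc_degree Q)"] var1
      nc_bounded_imp_degree_le[OF Q_bounded] by (simp_all add: R_def)
  have "R \<in> nc_polys N"
    unfolding R_def
    by (rule nc_bounded_imp_nc_polys,
        rule nc_bounded_mult[OF Q_bounded nc_bounded_power[OF nc_bounded_var[where D = 1]]])
      (use assms(4) in \<open>auto simp: N_def\<close>)

  have "nc_eval scale R a = (\<lambda>v. 0)" if a: "a \<in> {1..N} \<rightarrow> A" for a
  proof -
    \<comment> \<open>Outside the relevant variables an assignment is arbitrary; \<open>b\<close> makes it linear everywhere.\<close>
    define b where "b i = (if i \<in> {1..N} then a i else id)" for i
    have bA: "b i \<in> A" for i
      using a assms(2) by (auto simp: b_def operator_algebra_def)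
    then have lin: "Vector_Spaces.linear scale scale (b i)" for i
      using assms(2) by (auto simp: operator_algebra_def)
    have "lin_dep_family scale {0..<m} (\<lambda>i. nc_eval scale (x i) b v)" for v
    proof -
      have "lin_dep_family scale {1..m} (\<lambda>j. nc_eval scale (f j) b v)"
        using assms(6) bA by (simp add: locally_dir_lin_dep_def)
      then obtain \<alpha> j where \<alpha>: "j \<in> {1..m}" "\<alpha> j \<noteq> 0"
          "(\<Sum>i\<in>{1..m}. scale (\<alpha> i) (nc_eval scale (f i) b v)) = 0"
        by (rule lin_dep_familyE)
      have "(\<Sum>i\<in>{0..<m}. scale (\<alpha> (Suc i)) (nc_eval scale (x i) b v))
          = (\<Sum>i\<in>{1..m}. scale (\<alpha> i) (nc_eval scale (f i) b v))"
        by (rule sum.reindex_bij_witness[of _ "\<lambda>i. i - 1" Suc]) (auto simp: x_def)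
      then show ?thesis
        using \<alpha> by (intro lin_dep_familyI[of "j - 1" _ "\<lambda>i. \<alpha> (Suc i)"]) auto
    qed
    then obtain \<alpha> j where \<alpha>: "j \<in> {0..<m}" "\<alpha> j \<noteq> 0"
        "rank_le scale (\<lambda>v. \<Sum>i\<in>{0..<m}. scale (\<alpha> i) (nc_eval scale (x i) b v)) (m - 1)"
      using local_dependence_rank[of "{0..<m}" "\<lambda>i. nc_eval scale (x i) b"] linear_nc_eval[OF lin] assms(3)
      by auto
    then have "rank_le scale (nc_eval scale P b) (fact (m - 0) * (m - 1))"
      unfolding P_def by (intro rank_le_capelli[OF lin])
    then have "rank_le scale (nc_eval scale P b) d"
      by (simp add: assms(7) mult.commute)
    then have "nc_eval scale Q b v = 0" for v
      unfolding Q_def by (rule capelli_of_powers_vanishes[OF lin])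
    then have "nc_eval scale R b = (\<lambda>v. 0)"
      by (simp add: R_def nc_eval_mult_linear[OF lin] fun_eq_iff)
    moreover have "nc_eval scale R a = nc_eval scale R b"
      using \<open>R \<in> nc_polys N\<close> by (rule nc_eval_cong) (simp add: b_def)
    ultimately show ?thesis
      by simp
  qed
  then have "polynomial_identity scale A N R"
    using \<open>R \<in> nc_polys N\<close> \<open>R \<noteq> 0\<close> by (simp add: polynomial_identity_def)
  then show False
    using assms(9) \<open>nc_degree R = \<gamma>\<close> unfolding satisfies_PI_of_degree_def by blast
qed

end
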